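(* We have $$ \mathrm m((1+x_1)^2+x_2+x_3) =\frac{8\Gamma(\frac34)^2}{\pi^{5/2}}\, {}_5F_4\left(\tfrac14,\tfrac14,\tfrac14,\tfrac34,\tfrac34;\tfrac12,\tfrac54,\tfrac54,\tfrac54;\tfrac14\right) +\frac{\Gamma(\frac14)^2}{54\pi^{5/2}}\, {}_5F_4\left(\tfrac34,\tfrac34,\tfrac34,\tfrac54,\tfrac54;\tfrac32,\tfrac74,\tfrac74,\tfrac74;\tfrac14\right). $$
   Context: For a nonzero Laurent polynomial $P(x_1,\dots,x_N)$, $\mathrm m(P)=\int_{[0,1]^N}\log|P(e^{2\pi i\theta_1},\dots,e^{2\pi i\theta_N})|\,d\theta_1\cdots d\theta_N$ is its Mahler measure. The generalized hypergeometric series is ${}_5F_4(a_1,\dots,a_5;b_2,\dots,b_5;z)=\sum_{n\ge0}\frac{(a_1)_n\cdots(a_5)_n}{(b_2)_n\cdots(b_5)_n}\frac{z^n}{n!}$ with $(a)_n=\Gamma(a+n)/\Gamma(a)$. *)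

theory Defs
  imports "HOL-Analysis.Analysis"
begin

definition unit_circ :: "real \<Rightarrow> complex" where
  "unit_circ t = exp (2 * of_real pi * \<i> * of_real t)"

definition mahler_measure3 :: "(complex \<Rightarrow> complex \<Rightarrow> complex \<Rightarrow> complex) \<Rightarrow> real" where
  "mahler_measure3 P =
     (LINT t:{0..1::real} \<times> {0..1::real} \<times> {0..1::real}|lborel.
        ln (cmod (P (unit_circ (fst t)) (unit_circ (fst (snd t))) (unit_circ (snd (snd t))))))"

definition hyp5F4 :: "real \<Rightarrow> real \<Rightarrow> real \<Rightarrow> real \<Rightarrow> real \<Rightarrow>
    real \<Rightarrow> real \<Rightarrow> real \<Rightarrow> real \<Rightarrow> real \<Rightarrow> real" where
  "hyp5F4 a1 a2 a3 a4 a5 b2 b3 b4 b5 z =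
     (\<Sum>n. (pochhammer a1 n * pochhammer a2 n * pochhammer a3 n * pochhammer a4 n * pochhammer a5 n)
          / (pochhammer b2 n * pochhammer b3 n * pochhammer b4 n * pochhammer b5 n)
          * z ^ n / fact n)"

end

theory Submission
  imports Defs "HOL-Complex_Analysis.Complex_Analysis" "HOL-Real_Asymp.Real_Asymp"
begin

text \<open>
  Putting \<open>x\<^sub>3 = u x\<^sub>2\<close> and averaging over \<open>x\<^sub>2\<close> with Jensen's formula, which depends only on the
  absolute values of \<open>(1 + x)\<^sup>2\<close> and \<open>1 + u\<close>, the Mahler measure becomes the mean of
  \<open>max (2 log \<bar>1 + x\<bar>) (log \<bar>1 + u\<bar>)\<close> for independent uniform \<open>x\<close> and \<open>u\<close>.
  Since \<open>log \<bar>1 + x\<bar>\<close> has mean zero, the average over \<open>x\<close> alone, with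
  \<open>r = \<bar>1 + u\<bar> \<le> 2\<close>, is the mean of the positive part of \<open>log r - 2 log \<bar>1 + x\<bar>\<close>. An antiderivative of
  \<open>log (2 sin (\<pi> t))\<close> involves \<open>\<integral> arcsin q / q dq\<close>, so this function (called \<open>excess r\<close> below) is a power
  series in \<open>r\<close> times \<open>sqrt r\<close>, with nonnegative coefficients. Its mean over \<open>u\<close> is computed termwise by
  the Beta integral for the moments of \<open>\<bar>1 + u\<bar>\<close>, and the terms of even and odd index form the two
  hypergeometric series.

  Replacing \<open>ln \<bar>P\<bar>\<close> by \<open>ln 6 - ln \<bar>P\<bar> \<ge> 0\<close> lets Tonelli's theorem apply without a prior proof of integrability.
\<close>

subsection \<open>Integrals over the circle\<close>

lemma unit_circ_cis: "unit_circ t = cis (2 * pi * t)"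
  by (simp add: unit_circ_def cis_conv_exp mult_ac)

lemma norm_unit_circ [simp]: "cmod (unit_circ t) = 1"
  by (simp add: unit_circ_cis)

lemma unit_circ_nonzero [simp]: "unit_circ t \<noteq> 0"
  by (simp add: unit_circ_def)

lemma unit_circ_add: "unit_circ (s + t) = unit_circ s * unit_circ t"
  by (simp add: unit_circ_cis cis_mult ring_distribs)

lemma unit_circ_plus_one: "unit_circ (t + 1) = unit_circ t"
  by (simp add: unit_circ_cis ring_distribs complex_eq_iff)

lemma continuous_on_unit_circ [continuous_intros]: "continuous_on S unit_circ"
  unfolding unit_circ_def by (intro continuous_intros)

lemma unit_circ_measurable [measurable]: "unit_circ \<in> borel_measurable borel"
  by (intro borel_measurable_continuous_onI continuous_intros)

lemma one_plus_unit_circ_eq: "1 + unit_circ t = 2 * of_real (cos (pi * t)) * cis (pi * t)"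
proof -
  have "unit_circ t = cis (pi * t) * cis (pi * t)"
    by (simp add: unit_circ_cis cis_mult mult_ac)
  moreover have "1 = cis (pi * t) * cis (- (pi * t))"
    by (simp add: cis_mult)
  moreover have "cis (- (pi * t)) + cis (pi * t) = 2 * of_real (cos (pi * t))"
    by (simp add: complex_eq_iff)
  ultimately show ?thesis
    by (metis distrib_left mult.commute)
qed

lemma norm_one_plus_unit_circ: "cmod (1 + unit_circ t) = 2 * \<bar>cos (pi * t)\<bar>"
  by (simp add: one_plus_unit_circ_eq norm_mult)

lemma nn_integral_Icc_shift:
  fixes h :: "real \<Rightarrow> ennreal"
  assumes [measurable]: "h \<in> borel_measurable borel"
  shows "(\<integral>\<^sup>+t\<in>{a..b}. h (t + s) \<partial>lborel) = (\<integral>\<^sup>+t\<in>{a+s..b+s}. h t \<partial>lborel)"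
proof -
  have *: "(indicator {a+s..b+s} (x + s) :: ennreal) = indicator {a..b} x" for x :: real
    by (auto simp: indicator_def)
  show ?thesis
    by (subst nn_integral_real_affine[where c = 1 and t = s and
          f = "\<lambda>t. h t * indicator {a+s..b+s} t"]) (simp_all add: * add.commute[of s])
qed

lemma nn_integral_Icc_reflect:
  fixes h :: "real \<Rightarrow> ennreal"
  assumes [measurable]: "h \<in> borel_measurable borel"
  shows "(\<integral>\<^sup>+t\<in>{a..b}. h (s - t) \<partial>lborel) = (\<integral>\<^sup>+t\<in>{s-b..s-a}. h t \<partial>lborel)"
proof -
  have *: "(indicator {s-b..s-a} (s - x) :: ennreal) = indicator {a..b} x" for x :: real
    by (auto simp: indicator_def)
  show ?thesis
    by (subst nn_integral_real_affine[where c = "-1" and t = s and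
          f = "\<lambda>t. h t * indicator {s-b..s-a} t"]) (simp_all add: *)
qed

lemma nn_integral_Icc_split:
  fixes h :: "real \<Rightarrow> ennreal"
  assumes [measurable]: "h \<in> borel_measurable borel" and "a \<le> c" "c \<le> b"
  shows "(\<integral>\<^sup>+t\<in>{a..b}. h t \<partial>lborel) = (\<integral>\<^sup>+t\<in>{a..c}. h t \<partial>lborel) + (\<integral>\<^sup>+t\<in>{c..b}. h t \<partial>lborel)"
proof -
  have "(\<integral>\<^sup>+t\<in>{a..b}. h t \<partial>lborel)
      = (\<integral>\<^sup>+t. h t * indicator {a..c} t + h t * indicator {c..b} t \<partial>lborel)"
    by (intro nn_integral_cong_AE AE_I[where N = "{c}"])
       (use assms in \<open>auto simp: indicator_def\<close>)
  thus ?thesis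
    by (simp add: nn_integral_add)
qed

text \<open>Rotation invariance: the piece of \<open>{s..1+s}\<close> beyond \<open>1\<close> is
  carried back to \<open>{0..s}\<close> by the period. It serves the substitution
  \<open>x3 = u * x2\<close> and the case of equal moduli in Jensen's formula.\<close>

lemma nn_integral_periodic_shift:
  fixes h :: "real \<Rightarrow> ennreal"
  assumes [measurable]: "h \<in> borel_measurable borel" and per: "\<And>t. h (t + 1) = h t"
    and s: "0 \<le> s" "s \<le> 1"
  shows "(\<integral>\<^sup>+t\<in>{0..1}. h (t + s) \<partial>lborel) = (\<integral>\<^sup>+t\<in>{0..1}. h t \<partial>lborel)"
proof -
  have "(\<integral>\<^sup>+t\<in>{0..1}. h (t + s) \<partial>lborel) = (\<integral>\<^sup>+t\<in>{s..1+s}. h t \<partial>lborel)"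
    by (subst nn_integral_Icc_shift) simp_all
  also have "\<dots> = (\<integral>\<^sup>+t\<in>{s..1}. h t \<partial>lborel) + (\<integral>\<^sup>+t\<in>{1..1+s}. h t \<partial>lborel)"
    using s by (intro nn_integral_Icc_split) auto
  also have "(\<integral>\<^sup>+t\<in>{1..1+s}. h t \<partial>lborel) = (\<integral>\<^sup>+t\<in>{0..s}. h t \<partial>lborel)"
    using nn_integral_Icc_shift[where h = h and a = 0 and b = s and s = 1] by (simp add: per add.commute)
  also have "(\<integral>\<^sup>+t\<in>{s..1}. h t \<partial>lborel) + \<dots> = (\<integral>\<^sup>+t\<in>{0..1}. h t \<partial>lborel)"
    using nn_integral_Icc_split[of h 0 s 1] s by (simp add: add.commute)
  finally show ?thesis .
qed

text \<open>Since \<open>cmod (1 + unit_circ t) = 2 * \<bar>cos (pi * t)\<bar>\<close>, the circle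
  is cut at the zero \<open>t = 1/2\<close>. Reflecting the first half and translating the second
  moves the zero to \<open>t = 0\<close> in both, and the absolute value becomes a sine that
  increases on \<open>{0..1/2}\<close>.\<close>

lemma nn_integral_circle_eq_sine:
  fixes h :: "real \<Rightarrow> ennreal"
  assumes [measurable]: "h \<in> borel_measurable borel"
  shows "(\<integral>\<^sup>+t\<in>{0..1}. h (cmod (1 + unit_circ t)) \<partial>lborel)
       = 2 * (\<integral>\<^sup>+t\<in>{0..1/2}. h (2 * sin (pi * t)) \<partial>lborel)"
proof -
  define g where "g = (\<lambda>t. h (2 * sin (pi * t)))"
  have [measurable]: "g \<in> borel_measurable borel" unfolding g_def by measurable
  have nonneg: "0 \<le> cos (pi * t)" "0 \<le> sin (pi * t)" if "0 \<le> t" "t \<le> 1/2" for t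
  proof -
    have b: "0 \<le> pi * t" "pi * t \<le> pi / 2"
      using that mult_left_mono[of t "1/2" pi] by auto
    hence b': "- (pi / 2) \<le> pi * t" "pi * t \<le> pi"
      using pi_gt_zero by linarith+
    show "0 \<le> cos (pi * t)" "0 \<le> sin (pi * t)"
      by (rule cos_ge_zero[OF b'(1) b(2)], rule sin_ge_zero[OF b(1) b'(2)])
  qed
  have "(\<integral>\<^sup>+t\<in>{0..1/2}. h (cmod (1 + unit_circ t)) \<partial>lborel) = (\<integral>\<^sup>+t\<in>{0..1/2}. g (1/2 - t) \<partial>lborel)"
    by (intro nn_integral_cong)
       (auto simp: indicator_def g_def norm_one_plus_unit_circ right_diff_distrib sin_diff nonneg)
  also have "\<dots> = (\<integral>\<^sup>+t\<in>{0..1/2}. g t \<partial>lborel)"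
    by (subst nn_integral_Icc_reflect) simp_all
  finally have 1: "(\<integral>\<^sup>+t\<in>{0..1/2}. h (cmod (1 + unit_circ t)) \<partial>lborel) = (\<integral>\<^sup>+t\<in>{0..1/2}. g t \<partial>lborel)" .
  have "(\<integral>\<^sup>+t\<in>{1/2..1}. h (cmod (1 + unit_circ t)) \<partial>lborel) = (\<integral>\<^sup>+t\<in>{0..1/2}. h (cmod (1 + unit_circ (t + 1/2))) \<partial>lborel)"
    by (subst nn_integral_Icc_shift[where h = "\<lambda>t. h (cmod (1 + unit_circ t))"]) simp_all
  also have "\<dots> = (\<integral>\<^sup>+t\<in>{0..1/2}. g t \<partial>lborel)"
    by (intro nn_integral_cong)
       (auto simp: indicator_def g_def norm_one_plus_unit_circ distrib_left cos_add nonneg)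
  finally have 2: "(\<integral>\<^sup>+t\<in>{1/2..1}. h (cmod (1 + unit_circ t)) \<partial>lborel) = (\<integral>\<^sup>+t\<in>{0..1/2}. g t \<partial>lborel)" .
  have "(\<integral>\<^sup>+t\<in>{0..1}. h (cmod (1 + unit_circ t)) \<partial>lborel)
      = (\<integral>\<^sup>+t\<in>{0..1/2}. g t \<partial>lborel) + (\<integral>\<^sup>+t\<in>{0..1/2}. g t \<partial>lborel)"
    using nn_integral_Icc_split[of "\<lambda>t. h (cmod (1 + unit_circ t))" 0 "1/2" 1] unfolding 1 2 by simp
  thus ?thesis
    unfolding g_def mult_2 .
qed

subsection \<open>The power series of the arcsine\<close>

text \<open>Termwise, \<open>q ^ (2 * n + 1)\<close> differentiates to
  \<open>(2 * n + 1) * (q\<^sup>2) ^ n\<close>. Each application clears one factor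
  \<open>2 * n + 1\<close> from a denominator: from \<open>arcsin_integral\<close> to
  \<open>arcsin q / q\<close>, and from the arcsine to the binomial series.\<close>

lemma has_derivative_odd_series:
  fixes c :: "nat \<Rightarrow> real"
  assumes c: "\<And>x. norm x < 1 \<Longrightarrow> summable (\<lambda>n. c n * x ^ n)" and q: "\<bar>q\<bar> < 1"
  shows "((\<lambda>q. q * (\<Sum>n. c n * (q\<^sup>2) ^ n)) has_real_derivative (\<Sum>n. (2 * real n + 1) * c n * (q\<^sup>2) ^ n)) (at q)"
proof -
  have q2: "norm (q\<^sup>2) < 1" using q by (simp add: abs_square_less_1)
  have "((\<lambda>z. \<Sum>n. c n * z ^ n) has_real_derivative (\<Sum>n. diffs c n * (q\<^sup>2) ^ n)) (at (q\<^sup>2))"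
    by (rule termdiffs_strong'[where K = 1]) (use c q2 in auto)
  hence "((\<lambda>q. \<Sum>n. c n * (q\<^sup>2) ^ n) has_real_derivative (\<Sum>n. diffs c n * (q\<^sup>2) ^ n) * (2 * q)) (at q)"
    by (rule DERIV_chain2[where g = "\<lambda>q. q\<^sup>2"]) (auto intro!: derivative_eq_intros)
  hence D: "((\<lambda>q. q * (\<Sum>n. c n * (q\<^sup>2) ^ n)) has_real_derivative
      ((\<Sum>n. c n * (q\<^sup>2) ^ n) + 2 * (q\<^sup>2 * (\<Sum>n. diffs c n * (q\<^sup>2) ^ n)))) (at q)"
    by (auto intro!: derivative_eq_intros simp: power2_eq_square)
  have s0: "(\<lambda>n. c n * (q\<^sup>2) ^ n) sums (\<Sum>n. c n * (q\<^sup>2) ^ n)"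
    using c q2 by (intro summable_sums) auto
  have "(\<lambda>n. diffs c n * (q\<^sup>2) ^ n) sums (\<Sum>n. diffs c n * (q\<^sup>2) ^ n)"
    by (intro summable_sums termdiff_converges[of _ 1]) (use c q2 in auto)
  from sums_mult[OF this, of "q\<^sup>2"]
  have "(\<lambda>n. real (Suc n) * c (Suc n) * (q\<^sup>2) ^ Suc n) sums (q\<^sup>2 * (\<Sum>n. diffs c n * (q\<^sup>2) ^ n))"
    by (simp add: diffs_def mult_ac)
  \<comment> \<open>The index shift costs nothing, because the term at \<open>n = 0\<close> carries
    the factor \<open>real n\<close>.\<close>
  hence "(\<lambda>n. real n * c n * (q\<^sup>2) ^ n) sums (q\<^sup>2 * (\<Sum>n. diffs c n * (q\<^sup>2) ^ n))"
    by (subst (asm) sums_Suc_iff) simp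
  from sums_add[OF s0 sums_mult[OF this, of 2]]
  have "(\<lambda>n. (2 * real n + 1) * c n * (q\<^sup>2) ^ n) sums
     ((\<Sum>n. c n * (q\<^sup>2) ^ n) + 2 * (q\<^sup>2 * (\<Sum>n. diffs c n * (q\<^sup>2) ^ n)))"
    by (simp add: algebra_simps)
  with D show ?thesis by (simp add: sums_iff)
qed

text \<open>The quotient \<open>pochhammer (1/2) n / fact n\<close> is the central binomial
  coefficient divided by \<open>4 ^ n\<close>. In the Pochhammer form the duplication formula can
  split it later, according to the parity of \<open>n\<close>.\<close>

definition arcsin_coeff :: "nat \<Rightarrow> real" where
  "arcsin_coeff n = pochhammer (1/2) n / fact n / (2 * real n + 1)"

lemma divide_le_self:
  fixes a b :: real
  shows "0 \<le> a \<Longrightarrow> 1 \<le> b \<Longrightarrow> a / b \<le> a"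
  by (simp add: divide_le_eq mult_le_cancel_left1)

text \<open>For \<open>\<bar>q\<bar> < 1\<close> this is the integral of \<open>arcsin x / x\<close>
  from \<open>0\<close> to \<open>q\<close>; defining it by its series lets the expansion of
  \<open>excess\<close> be read off.\<close>

definition arcsin_integral :: "real \<Rightarrow> real" where
  "arcsin_integral q = q * (\<Sum>n. arcsin_coeff n / (2 * real n + 1) * (q\<^sup>2) ^ n)"

lemma arcsin_coeff_nonneg: "0 \<le> arcsin_coeff n"
  by (simp add: arcsin_coeff_def pochhammer_nonneg)

text \<open>Newton's binomial series with exponent \<open>-1/2\<close>; the signs of the generalized
  binomial coefficient and of \<open>(-z) ^ n\<close> cancel.\<close>

lemma inverse_sqrt_sums:
  fixes z :: real
  assumes "\<bar>z\<bar> < 1"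
  shows "(\<lambda>n. pochhammer (1/2) n / fact n * z ^ n) sums inverse (sqrt (1 - z))"
proof -
  have "(\<lambda>n. (- (1/2) gchoose n) * (-z) ^ n) sums (1 + - z) powr (- (1/2))"
    using assms by (intro gen_binomial_real) auto
  moreover have "(- (1/2) gchoose n) * (-z) ^ n = pochhammer (1/2) n / fact n * z ^ n" for n
    by (simp add: gbinomial_pochhammer power_mult_distrib[of "-1" z, simplified] flip: power_add mult_2)
  moreover have "(1 + - z) powr (- (1/2)) = inverse (sqrt (1 - z))"
    using assms by (simp add: powr_minus powr_half_sqrt)
  ultimately show ?thesis by simp
qed

lemma summable_dominated_power_series:
  fixes b c :: "nat \<Rightarrow> real"
  assumes "\<And>n. 0 \<le> c n" "\<And>n. c n \<le> b n" "\<And>x. 0 \<le> x \<Longrightarrow> x < 1 \<Longrightarrow> summable (\<lambda>n. b n * x ^ n)" "norm x < 1"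
  shows "summable (\<lambda>n. c n * x ^ n)"
proof (rule summable_comparison_test')
  show "summable (\<lambda>n. b n * \<bar>x\<bar> ^ n)" using assms(4) by (intro assms(3)) auto
  show "norm (c n * x ^ n) \<le> b n * \<bar>x\<bar> ^ n" for n
    using assms(1,2)[of n] by (auto simp: abs_mult power_abs intro!: mult_right_mono)
qed

lemma summable_arcsin_coeff: "norm x < 1 \<Longrightarrow> summable (\<lambda>n. arcsin_coeff n * x ^ n)"
  by (rule summable_dominated_power_series[where b = "\<lambda>n. pochhammer (1/2) n / fact n"])
     (simp_all add: arcsin_coeff_nonneg arcsin_coeff_def pochhammer_nonneg divide_le_self
        sums_summable[OF inverse_sqrt_sums] del: divide_divide_eq_left times_divide_eq_left)

lemma summable_arcsin_integral_coeff:
  "norm x < 1 \<Longrightarrow> summable (\<lambda>n. arcsin_coeff n / (2 * real n + 1) * x ^ n)"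
  by (rule summable_dominated_power_series[where b = arcsin_coeff])
     (auto simp: arcsin_coeff_nonneg summable_arcsin_coeff intro!: divide_le_self)

text \<open>Both sides vanish at \<open>0\<close> and have the derivative
  \<open>inverse (sqrt (1 - x\<^sup>2))\<close>, on the left by the binomial series.\<close>

lemma arcsin_series:
  assumes "\<bar>q\<bar> < 1"
  shows "q * (\<Sum>n. arcsin_coeff n * (q\<^sup>2) ^ n) = arcsin q"
proof -
  let ?f = "\<lambda>q. q * (\<Sum>n. arcsin_coeff n * (q\<^sup>2) ^ n) - arcsin q"
  have "(?f has_real_derivative 0) (at x within {-1<..<1})" if "x \<in> {-1<..<1}" for x
  proof -
    have x: "\<bar>x\<bar> < 1" using that by auto
    have "(\<Sum>n. (2 * real n + 1) * arcsin_coeff n * (x\<^sup>2) ^ n) = inverse (sqrt (1 - x\<^sup>2))"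
    proof -
      have "(2 * real n + 1) * arcsin_coeff n = pochhammer (1/2) n / fact n" for n
        by (simp add: arcsin_coeff_def add_eq_0_iff)
      thus ?thesis
        using inverse_sqrt_sums[of "x\<^sup>2"] x by (simp add: sums_iff abs_square_less_1)
    qed
    with has_derivative_odd_series[OF summable_arcsin_coeff x]
    have "((\<lambda>q. q * (\<Sum>n. arcsin_coeff n * (q\<^sup>2) ^ n)) has_real_derivative inverse (sqrt (1 - x\<^sup>2))) (at x)"
      by simp
    from DERIV_diff[OF this DERIV_arcsin] that have "(?f has_real_derivative 0) (at x)" by simp
    thus ?thesis by (rule DERIV_subset) simp
  qed
  from has_field_derivative_zero_constant[OF _ this]
  obtain c where c: "\<And>x. x \<in> {-1<..<1} \<Longrightarrow> ?f x = c" by blast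
  have "c = 0" using c[of 0] by simp
  moreover have "q \<in> {-1<..<1}" using assms by auto
  ultimately show ?thesis using c[of q] by simp
qed

text \<open>The point \<open>0\<close> is excluded because \<open>arcsin 0 / 0\<close> evaluates to
  \<open>0\<close>, whereas the derivative of the series there is \<open>1\<close>.\<close>

lemma arcsin_integral_deriv:
  assumes "\<bar>q\<bar> < 1" "q \<noteq> 0"
  shows "(arcsin_integral has_real_derivative arcsin q / q) (at q)"
proof -
  have "(\<Sum>n. (2 * real n + 1) * (arcsin_coeff n / (2 * real n + 1)) * (q\<^sup>2) ^ n) = (\<Sum>n. arcsin_coeff n * (q\<^sup>2) ^ n)"
    by (intro suminf_cong) (simp add: add_eq_0_iff)
  also have "\<dots> = arcsin q / q"
    using arcsin_series[OF assms(1)] assms(2) by (simp add: field_simps)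
  finally show ?thesis
    using has_derivative_odd_series[OF summable_arcsin_integral_coeff assms(1)]
    unfolding arcsin_integral_def[abs_def] by simp
qed

lemma continuous_on_arcsin_integral:
  "continuous_on {-1<..<1} arcsin_integral"
  unfolding arcsin_integral_def[abs_def]
  by (rule DERIV_continuous_on, rule has_field_derivative_at_within,
      rule has_derivative_odd_series[OF summable_arcsin_integral_coeff]) auto

subsection \<open>Log-sine integrals and moments of the sine\<close>

lemma sin_pi_pos: "0 < t \<Longrightarrow> t < 1 \<Longrightarrow> 0 < sin (pi * t)"
  by (intro sin_gt_zero) auto

lemma sin_pi_less_one: "0 \<le> t \<Longrightarrow> t < 1/2 \<Longrightarrow> sin (pi * t) < 1"
  using sin_monotone_2pi[of "pi * t" "pi / 2"] pi_gt_zero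
    mult_strict_left_mono[of t "1/2" pi] mult_nonneg_nonneg[of pi t] by (simp del: pi_gt_zero; linarith)

lemma arcsin_sin_pi: "\<bar>t\<bar> \<le> 1/2 \<Longrightarrow> arcsin (sin (pi * t)) = pi * t"
  using mult_left_mono[of t "1/2" pi] mult_left_mono[of "-1/2" t pi] by (intro arcsin_sin) auto

lemma tendsto_mult_log_sine: "((\<lambda>t. t * ln (2 * sin (pi * t))) \<longlongrightarrow> 0) (at_right 0)"
  by real_asymp

text \<open>Integration by parts leaves the integral of
  \<open>pi * t * cos (pi * t) / sin (pi * t)\<close>, which the substitution
  \<open>q = sin (pi * t)\<close> turns into that of \<open>arcsin q / q\<close>, divided by
  \<open>pi\<close>. The bound \<open>\<tau> < 1/2\<close> keeps \<open>q\<close> below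
  \<open>1\<close>.\<close>

lemma log_sine_integral:
  assumes "0 < \<tau>" "\<tau> < 1/2"
  shows "((\<lambda>t. ln (2 * sin (pi * t))) has_integral
           (\<tau> * ln (2 * sin (pi * \<tau>)) - arcsin_integral (sin (pi * \<tau>)) / pi)) {0..\<tau>}"
proof -
  define \<Phi> where "\<Phi> = (\<lambda>t. t * ln (2 * sin (pi * t)) - arcsin_integral (sin (pi * t)) / pi)"
  have deriv: "(\<Phi> has_real_derivative ln (2 * sin (pi * t))) (at t)" if "0 < t" "t \<le> \<tau>" for t
  proof -
    have s: "0 < sin (pi * t)" "sin (pi * t) < 1"
      using that assms by (auto intro!: sin_pi_pos sin_pi_less_one)
    have "((\<lambda>t. arcsin_integral (sin (pi * t))) has_real_derivative
        arcsin (sin (pi * t)) / sin (pi * t) * (cos (pi * t) * pi)) (at t)"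
      by (rule DERIV_chain2[OF arcsin_integral_deriv]) (use s in \<open>auto intro!: derivative_eq_intros\<close>)
    moreover have "arcsin (sin (pi * t)) = pi * t"
      using that assms by (intro arcsin_sin_pi) auto
    ultimately show ?thesis
      unfolding \<Phi>_def using s by (auto intro!: derivative_eq_intros simp: field_simps)
  qed
  \<comment> \<open>The logarithm is singular at \<open>0\<close>, so the derivative is available
    only to the right of it; the fundamental theorem is content with continuity of
    \<open>\<Phi>\<close> at that end.\<close>
  have "((\<lambda>t. arcsin_integral (sin (pi * t))) \<longlongrightarrow> arcsin_integral (sin (pi * 0))) (at_right 0)"
  proof -
    have "isCont arcsin_integral (sin (pi * 0))"
      using continuous_on_arcsin_integral by (simp add: continuous_on_eq_continuous_at)
    hence "isCont (\<lambda>t. arcsin_integral (sin (pi * t))) 0"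
      by (intro isCont_o2[where g = arcsin_integral and f = "\<lambda>t. sin (pi * t)"] continuous_intros) auto
    thus ?thesis by (simp add: isCont_def filterlim_at_split)
  qed
  hence "(\<Phi> \<longlongrightarrow> \<Phi> 0) (at_right 0)"
    using tendsto_diff[OF tendsto_mult_log_sine tendsto_divide[OF _ tendsto_const[of pi]]]
    unfolding \<Phi>_def by fastforce
  moreover have "(\<Phi> \<longlongrightarrow> \<Phi> t) (at_right t) \<and> (\<Phi> \<longlongrightarrow> \<Phi> t) (at_left t) \<and> \<Phi> \<midarrow>t\<rightarrow> \<Phi> t" if "0 < t" "t \<le> \<tau>" for t
    using DERIV_isCont[OF deriv[OF that]] by (simp add: isCont_def filterlim_at_split)
  ultimately have "continuous_on {0..\<tau>} \<Phi>"
    using assms by (intro continuous_on_IccI) (auto simp: less_imp_le)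
  hence "((\<lambda>t. ln (2 * sin (pi * t))) has_integral (\<Phi> \<tau> - \<Phi> 0)) {0..\<tau>}"
    using assms deriv
    by (intro fundamental_theorem_of_calculus_interior)
       (auto simp flip: has_real_derivative_iff_has_vector_derivative)
  thus ?thesis by (simp add: \<Phi>_def arcsin_integral_def)
qed

text \<open>The explicit antiderivative covers the singularity at \<open>0\<close> but not the
  endpoint \<open>1/2\<close>, near which the integrand is continuous. Integrability has to precede
  Euler's argument, which names the value of the integral before finding it.\<close>

lemma log_sine_integrable: "(\<lambda>t. ln (2 * sin (pi * t))) integrable_on {0..1/2}"
proof (rule Henstock_Kurzweil_Integration.integrable_combine[where c = "1/4"])
  show "(\<lambda>t. ln (2 * sin (pi * t))) integrable_on {0..1/4}"
    using log_sine_integral[of "1/4"] by (auto simp: integrable_on_def)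
  show "(\<lambda>t. ln (2 * sin (pi * t))) integrable_on {1/4..1/2}"
  proof (intro integrable_continuous_real continuous_intros ballI)
    fix t :: real assume "t \<in> {1/4..1/2}"
    thus "2 * sin (pi * t) \<noteq> 0" using sin_pi_pos[of t] by auto
  qed
qed auto

text \<open>Euler's argument: the duplication formula for the sine shows that the integral equals its own double.\<close>

lemma log_sine_integral_half: "((\<lambda>t. ln (2 * sin (pi * t))) has_integral 0) {0..1/2}"
proof -
  define f where "f = (\<lambda>t. ln (2 * sin (pi * t)))"
  obtain K where K: "(f has_integral K) {0..1/2}"
    using log_sine_integrable by (auto simp: f_def integrable_on_def)
  have reflect: "((\<lambda>t. g (c - t)) has_integral I) {c - b..c - a}" if "(g has_integral I) {a..b}"
    for g :: "real \<Rightarrow> real" and I a b c :: real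
    using has_integral_affinity[of g I a b "-1" c] that by (simp add: image_affinity_atLeastAtMost)
  have "((\<lambda>t. f t + f (1/2 - t)) has_integral (K + K)) {0..1/2}"
    using has_integral_add[OF K reflect[OF K, of "1/2", simplified]] by simp
  hence "((\<lambda>t. f (2 * t)) has_integral (K + K)) {0..1/2}"
  \<comment> \<open>The endpoints are exempted: there \<open>ln 0 = 0\<close> breaks the rule for
    the logarithm of a product.\<close>
  proof (rule has_integral_spike_finite[of "{0, 1/2}", rotated 2])
    fix t :: real assume "t \<in> {0..1/2} - {0, 1/2}"
    hence t: "0 < t" "t < 1/2" by auto
    have c: "sin (pi * (1/2 - t)) = cos (pi * t)" by (simp add: right_diff_distrib sin_diff)
    have "0 < sin (pi * t)" "0 < sin (pi * (1/2 - t))" using t by (auto intro!: sin_pi_pos)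
    thus "f (2 * t) = f t + f (1/2 - t)"
      unfolding f_def c using sin_double[of "pi * t"]
      by (subst ln_mult_pos [symmetric]) (auto simp: mult_ac)
  qed auto
  \<comment> \<open>Rescaling gives \<open>K / 2\<close> on \<open>{0..1/4}\<close>; the symmetry of
    \<open>sin (2 * pi * t)\<close> about \<open>t = 1/4\<close> gives the same on the other
    half.\<close>
  moreover have "((\<lambda>t. f (2 * t)) has_integral (K / 2 + K / 2)) {0..1/2}"
  proof (rule has_integral_combine[where c = "1/4"])
    have 1: "((\<lambda>t. f (2 * t)) has_integral (K / 2)) {0..1/4}"
      using has_integral_affinity'[of f K 0 "1/2" 2 0] K by simp
    show "((\<lambda>t. f (2 * t)) has_integral (K / 2)) {0..1/4}" by fact
    have "f (2 * (1/2 - t)) = f (2 * t)" for t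
      by (simp add: f_def right_diff_distrib sin_diff)
    thus "((\<lambda>t. f (2 * t)) has_integral (K / 2)) {1/4..1/2}"
      using reflect[OF 1, of "1/2"] by simp
  qed auto
  ultimately have "K + K = K / 2 + K / 2" by (rule has_integral_unique)
  with K show ?thesis by (simp add: f_def)
qed

text \<open>As \<open>2 * ln (2 * sin (pi * t))\<close> integrates to \<open>0\<close>, it may be
  subtracted. The difference is supported on \<open>{0..\<tau>}\<close>, where \<open>\<tau>\<close>
  is the crossing point \<open>2 * sin (pi * \<tau>) = sqrt r\<close>, and the boundary term of
  \<open>log_sine_integral\<close> cancels against \<open>\<tau> * ln r\<close>. The bound
  \<open>r \<le> 2\<close> gives \<open>\<tau> \<le> 1/4\<close>, within reach of that
  lemma.\<close>

lemma max_log_sine_integral: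
  assumes r: "0 < r" "r \<le> 2"
  shows "((\<lambda>t. max (2 * ln (2 * sin (pi * t))) (ln r)) has_integral (2 / pi * arcsin_integral (sqrt r / 2))) {0..1/2}"
proof -
  define \<tau> where "\<tau> = arcsin (sqrt r / 2) / pi"
  have "1 / sqrt 2 = sqrt 2 / (2::real)" by (simp add: field_simps)
  hence q: "0 < sqrt r / 2" "sqrt r / 2 \<le> 1 / sqrt 2"
    using r real_sqrt_le_mono[of r 2] by auto
  have q1: "1 / sqrt 2 < (1::real)" by simp
  have "arcsin (sqrt r / 2) \<le> pi / 4"
    unfolding arcsin_one_over_sqrt_2[symmetric] using q q1 by (intro arcsin_le_arcsin; linarith)
  moreover have "0 < arcsin (sqrt r / 2)"
  proof -
    have "arcsin 0 < arcsin (sqrt r / 2)" using q q1 by (intro arcsin_less_arcsin; linarith)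
    thus ?thesis by simp
  qed
  ultimately have \<tau>: "0 < \<tau>" "\<tau> < 1/2"
    using pi_gt_zero by (auto simp: \<tau>_def field_simps)
  have sin: "sin (pi * \<tau>) = sqrt r / 2" 
  proof -
    have "sin (arcsin (sqrt r / 2)) = sqrt r / 2" using q q1 by (intro sin_arcsin; linarith)
    thus ?thesis by (simp add: \<tau>_def)
  qed
  have lnr: "ln r = 2 * ln (2 * sin (pi * \<tau>))" using r by (simp add: sin ln_sqrt)
  have mono: "2 * ln (2 * sin (pi * s)) \<le> 2 * ln (2 * sin (pi * t))" if "0 < s" "s \<le> t" "t \<le> 1/2" for s t
  proof -
    have "sin (pi * s) \<le> sin (pi * t)"
    proof (rule sin_monotone_2pi_le)
      have "0 \<le> pi * s" using that by simp
      thus "- (pi / 2) \<le> pi * s" using pi_gt_zero by linarith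
    qed (use that in auto)
    thus ?thesis using that sin_pi_pos[of s] by simp
  qed
  let ?d = "\<lambda>t. max (2 * ln (2 * sin (pi * t))) (ln r) - 2 * ln (2 * sin (pi * t))"
  have "((\<lambda>t. ln r - 2 * ln (2 * sin (pi * t))) has_integral
      (\<tau> * ln r - 2 * (\<tau> * ln (2 * sin (pi * \<tau>)) - arcsin_integral (sin (pi * \<tau>)) / pi))) {0..\<tau>}"
    using has_integral_diff[OF has_integral_const_real[of "ln r" 0 \<tau>]
        has_integral_mult_right[OF log_sine_integral[OF \<tau>], of 2]] \<tau> by simp
  also have "\<tau> * ln r - 2 * (\<tau> * ln (2 * sin (pi * \<tau>)) - arcsin_integral (sin (pi * \<tau>)) / pi)
      = 2 / pi * arcsin_integral (sqrt r / 2)"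
    unfolding lnr unfolding sin by (simp add: algebra_simps)
  finally have 1: "(?d has_integral (2 / pi * arcsin_integral (sqrt r / 2))) {0..\<tau>}"
  \<comment> \<open>The point \<open>t = 0\<close> is exempted because \<open>ln 0 = 0\<close> may
    exceed \<open>ln r\<close> there.\<close>
  proof (rule has_integral_spike_finite[of "{0}", rotated 2])
    fix t assume "t \<in> {0..\<tau>} - {0}"
    with \<tau> mono[of t \<tau>] show "?d t = ln r - 2 * ln (2 * sin (pi * t))" unfolding lnr by auto
  qed auto
  have 2: "(?d has_integral 0) {\<tau>..1/2}"
    using \<tau> mono[of \<tau>] unfolding lnr by (intro has_integral_is_0) auto
  have "(?d has_integral (2 / pi * arcsin_integral (sqrt r / 2) + 0)) {0..1/2}"
    using \<tau> by (intro has_integral_combine[OF _ _ 1 2]) auto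
  from has_integral_add[OF this has_integral_mult_right[OF log_sine_integral_half, of 2]]
  show ?thesis by simp
qed

text \<open>Substituting \<open>x = (sin (pi * t))\<^sup>2\<close> turns the Beta integral into
  \<open>2 * pi\<close> times the one sought: the derivative supplies a sine and a cosine, and the
  cosine cancels against \<open>(1 - x) powr (1 / 2 - 1)\<close>. Open intervals keep away from the
  endpoint singularities.\<close>

lemma sine_powr_integral:
  fixes s :: real
  assumes "s > -1"
  shows "((\<lambda>t. sin (pi * t) powr s) has_integral (Beta ((s + 1) / 2) (1 / 2) / (2 * pi))) {0..1/2}"
proof -
  define g where "g = (\<lambda>t. (sin (pi * t))\<^sup>2)"
  define g' where "g' = (\<lambda>t. 2 * pi * sin (pi * t) * cos (pi * t))"
  define f where "f = (\<lambda>x::real. x powr ((s + 1) / 2 - 1) * (1 - x) powr (1 / 2 - 1))"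
  have pos: "0 < sin (pi * t)" "sin (pi * t) < 1" "0 < cos (pi * t)" if "t \<in> {0<..<1/2}" for t
    using that sin_pi_pos[of t] sin_pi_less_one[of t] sin_pi_pos[of "1/2 - t"]
    by (auto simp: right_diff_distrib sin_diff)
  have inv: "arcsin (sqrt (g t)) / pi = t" if "t \<in> {0<..<1/2}" for t
    using that pos[OF that] arcsin_sin_pi[of t] by (simp add: g_def)
  have image: "g ` {0<..<1/2} = {0<..<1}"
  proof (intro equalityI subsetI)
    fix x assume "x \<in> g ` {0<..<1/2}"
    then obtain t where "t \<in> {0<..<1/2}" "x = g t" by blast
    with pos[of t] show "x \<in> {0<..<1}" by (auto simp: g_def power2_less_1_iff)
  next
    fix x :: real assume x: "x \<in> {0<..<1}"
    hence "0 < arcsin (sqrt x)" "arcsin (sqrt x) < pi / 2"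
      using arcsin_less_arcsin[of 0 "sqrt x"] arcsin_less_arcsin[of "sqrt x" 1]
        order_trans[of "-1" 0 "sqrt x"] by auto
    moreover have "g (arcsin (sqrt x) / pi) = x"
      using x order_trans[of "-1" 0 "sqrt x"] by (simp add: g_def)
    ultimately show "x \<in> g ` {0<..<1/2}"
      by (intro image_eqI[of _ _ "arcsin (sqrt x) / pi"]) (auto simp: field_simps)
  qed
  have "(f has_integral Beta ((s + 1) / 2) (1 / 2)) {0<..<1}"
    using has_integral_Beta_real[of "(s + 1) / 2" "1 / 2"] assms
    by (simp add: f_def has_integral_Icc_iff_Ioo)
  hence "f absolutely_integrable_on g ` {0<..<1/2} \<and> integral (g ` {0<..<1/2}) f = Beta ((s + 1) / 2) (1 / 2)"
    unfolding image by (auto simp: f_def has_integral_iff intro!: nonnegative_absolutely_integrable_1)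
  hence "(\<lambda>t. \<bar>g' t\<bar> * f (g t)) absolutely_integrable_on {0<..<1/2} \<and>
      integral {0<..<1/2} (\<lambda>t. \<bar>g' t\<bar> * f (g t)) = Beta ((s + 1) / 2) (1 / 2)"
    by (subst has_absolute_integral_change_of_variables_1')
       (auto simp: g_def g'_def intro!: derivative_eq_intros inj_on_inverseI[where g = "\<lambda>x. arcsin (sqrt x) / pi"]
          inv[unfolded g_def])
  hence "((\<lambda>t. \<bar>g' t\<bar> * f (g t)) has_integral Beta ((s + 1) / 2) (1 / 2)) {0<..<1/2}"
    by (auto simp: has_integral_iff absolutely_integrable_on_def)
  moreover have "\<bar>g' t\<bar> * f (g t) = 2 * pi * sin (pi * t) powr s" if "t \<in> {0<..<1/2}" for t
  proof -
    note p = pos[OF that]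
    have "1 - g t = (cos (pi * t))\<^sup>2" by (simp add: g_def cos_squared_eq)
    hence "(1 - g t) powr (1 / 2 - 1) = inverse (cos (pi * t))"
      using p by (simp add: powr_minus powr_half_sqrt)
    moreover have "g t powr ((s + 1) / 2 - 1) = sin (pi * t) powr (s - 1)"
    proof -
      have "g t = sin (pi * t) powr 2" using p by (simp add: g_def)
      moreover have "2 * ((s + 1) / 2 - 1) = s - 1" by (simp add: field_simps)
      ultimately show ?thesis by (simp only: powr_powr)
    qed
    ultimately have "f (g t) = sin (pi * t) powr (s - 1) * inverse (cos (pi * t))"
      unfolding f_def by (simp only:)
    thus ?thesis
      using p by (simp add: g'_def abs_mult powr_diff field_simps)
  qed
  ultimately have "((\<lambda>t. 2 * pi * sin (pi * t) powr s) has_integral Beta ((s + 1) / 2) (1 / 2)) {0..1/2}"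
    unfolding has_integral_Icc_iff_Ioo by (subst (asm) has_integral_cong) auto
  from has_integral_mult_right[OF this, of "1 / (2 * pi)"] show ?thesis by simp
qed

subsection \<open>Jensen's formula for linear polynomials\<close>

text \<open>Passes from gauge integrals, found through antiderivatives, to the Lebesgue integrals to
  which Tonelli's theorem applies.\<close>

lemma nn_integral_Icc_has_integral:
  fixes f :: "real \<Rightarrow> real"
  assumes "\<And>t. t \<in> {a..b} \<Longrightarrow> 0 \<le> f t" "(f has_integral I) {a..b}"
  shows "(\<integral>\<^sup>+t\<in>{a..b}. ennreal (f t) \<partial>lborel) = ennreal I"
proof -
  have "(\<integral>\<^sup>+t\<in>{a..b}. ennreal (f t) \<partial>lborel) = (\<integral>\<^sup>+t. ennreal (indicator {a..b} t * f t) \<partial>lborel)"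
    by (intro nn_integral_cong) (auto simp: indicator_def)
  also have "\<dots> = ennreal I"
    by (rule nn_integral_has_integral_lebesgue) (use assms in auto)
  finally show ?thesis .
qed

text \<open>Mean value property: \<open>Ln (1 + z * u)\<close> is holomorphic on the closed unit
  disc and vanishes at \<open>u = 0\<close>; its real part is the logarithm in question.\<close>

lemma log_norm_circle_integral_eq_0:
  assumes z: "cmod z < 1"
  shows "((\<lambda>t. ln (cmod (1 + z * unit_circ t))) has_integral 0) {0..1}"
proof -
  \<comment> \<open>A positive real part keeps \<open>1 + z * u\<close> off the branch cut of
    \<open>Ln\<close>.\<close>
  have pos: "0 < Re (1 + z * u)" if "cmod u \<le> 1" for u
  proof -
    have "cmod (z * u) < 1"
      using that z mult_left_mono[of "cmod u" 1 "cmod z"] by (simp add: norm_mult)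
    thus ?thesis using abs_Re_le_cmod[of "z * u"] by auto
  qed
  let ?f = "\<lambda>u. Ln (1 + z * u)"
  have "?f holomorphic_on cball 0 1"
    by (intro holomorphic_intros) (use pos in \<open>force simp: complex_nonpos_Reals_iff\<close>)
  hence "((\<lambda>u. ?f u / (u - 0)) has_contour_integral (2 * of_real pi * \<i> * ?f 0)) (circlepath 0 1)"
    by (rule Cauchy_integral_circlepath_simple) auto
  hence "((\<lambda>t. ?f (unit_circ t) / unit_circ t * (2 * of_real pi * \<i> * unit_circ t)) has_integral 0) {0..1}"
    unfolding has_contour_integral vector_derivative_circlepath
    by (simp add: circlepath unit_circ_def)
  hence "((\<lambda>t. 2 * of_real pi * \<i> * ?f (unit_circ t)) has_integral 0) {0..1}"
    by (simp add: mult_ac)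
  from has_integral_mult_right[OF this, of "1 / (2 * of_real pi * \<i>)"]
  have "((\<lambda>t. ?f (unit_circ t)) has_integral 0) {0..1}"
    by simp
  from has_integral_linear[OF this bounded_linear_Re]
  have "((\<lambda>t. Re (?f (unit_circ t))) has_integral 0) {0..1}"
    by (simp add: o_def)
  moreover have "Re (?f (unit_circ t)) = ln (cmod (1 + z * unit_circ t))" for t
  proof (rule Re_Ln)
    show "1 + z * unit_circ t \<noteq> 0"
      using pos[of "unit_circ t"] by (metis norm_unit_circ order_refl less_irrefl zero_complex.sel(1))
  qed
  ultimately show ?thesis by simp
qed

text \<open>The single parameter \<open>1/2\<close> is the null set discarded in the
  almost-everywhere arguments below.\<close>

lemma one_plus_unit_circ_nonzero:
  assumes "t \<in> {0..1}" "t \<noteq> 1/2"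
  shows "1 + unit_circ t \<noteq> 0"
proof
  assume "1 + unit_circ t = 0"
  with assms show False
    using norm_one_plus_unit_circ[of t] sin_pi_pos[of "1/2 - t"] sin_pi_pos[of "t - 1/2"]
    by (cases t "1/2 :: real" rule: linorder_cases) (auto simp: right_diff_distrib sin_diff)
qed

lemma ln_two_sine_le: "0 \<le> t \<Longrightarrow> t \<le> 1/2 \<Longrightarrow> ln (2 * sin (pi * t)) \<le> ln 2"
  using sin_pi_pos[of t] by (cases "t = 0") auto

lemma ennreal_double_half: "2 * ennreal (x / 2) = ennreal x"
  using ennreal_mult'[of 2 "x / 2"] by simp

text \<open>Boundary case of Jensen's formula, where the zero on the circle rules out Cauchy's
  formula; the value comes from \<open>log_sine_integral_half\<close>. The bound on \<open>c\<close>
  makes the integrand nonnegative, so \<open>ennreal\<close> truncates nothing.\<close>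

lemma nn_integral_log_norm_one_plus_circle:
  assumes "ln 2 \<le> c"
  shows "(\<integral>\<^sup>+t\<in>{0..1}. ennreal (c - ln (cmod (1 + unit_circ t))) \<partial>lborel) = ennreal c"
proof -
  have "(\<integral>\<^sup>+t\<in>{0..1}. ennreal (c - ln (cmod (1 + unit_circ t))) \<partial>lborel)
      = 2 * (\<integral>\<^sup>+t\<in>{0..1/2}. ennreal (c - ln (2 * sin (pi * t))) \<partial>lborel)"
    by (subst nn_integral_circle_eq_sine[where h = "\<lambda>x. ennreal (c - ln x)"]) auto
  also have "(\<integral>\<^sup>+t\<in>{0..1/2}. ennreal (c - ln (2 * sin (pi * t))) \<partial>lborel) = ennreal (c / 2)"
  proof (rule nn_integral_Icc_has_integral)
    show "((\<lambda>t. c - ln (2 * sin (pi * t))) has_integral (c / 2)) {0..1/2}"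
      using has_integral_diff[OF has_integral_const_real[of c 0 "1/2"] log_sine_integral_half] by simp
  qed (use assms ln_two_sine_le in \<open>force\<close>)
  also have "2 * ennreal (c / 2) = ennreal c"
    by (rule ennreal_double_half)
  finally show ?thesis .
qed

text \<open>The hypothesis \<open>0 \<le> c\<close> accounts for the convention \<open>ln 0 = 0\<close> at a zero on the circle.\<close>

lemma nn_integral_jensen_linear:
  fixes a b :: complex
  assumes a: "a \<noteq> 0" and b: "b \<noteq> 0" and c: "0 \<le> c" "ln (cmod a + cmod b) \<le> c"
  shows "(\<integral>\<^sup>+t\<in>{0..1}. ennreal (c - ln (cmod (a + b * unit_circ t))) \<partial>lborel)
       = ennreal (c - max (ln (cmod a)) (ln (cmod b)))"
proof -
  have upper: "ln (cmod (a + b * unit_circ t)) \<le> c" for t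
  proof (cases "a + b * unit_circ t = 0")
    case False
    have "cmod (a + b * unit_circ t) \<le> cmod a + cmod b"
      using norm_triangle_ineq[of a "b * unit_circ t"] by (simp add: norm_mult)
    hence "ln (cmod (a + b * unit_circ t)) \<le> ln (cmod a + cmod b)"
      using False by (subst ln_le_cancel_iff) (auto intro: add_pos_pos simp: a b)
    with c show ?thesis by simp
  qed (use c in simp)
  consider "cmod b < cmod a" | "cmod a < cmod b" | "cmod a = cmod b" by linarith
  thus ?thesis
  proof cases
    case 1
    have "cmod (a + b * unit_circ t) = cmod a * cmod (1 + b / a * unit_circ t)" for t
      using a by (simp flip: norm_mult add: distrib_left)
    moreover have "1 + b / a * unit_circ t \<noteq> 0" for t
      using 1 a by (auto simp: add_eq_0_iff norm_divide field_simps dest!: arg_cong[of _ _ cmod] simp: norm_mult)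
    ultimately have eq: "ln (cmod (a + b * unit_circ t)) = ln (cmod a) + ln (cmod (1 + b / a * unit_circ t))" for t
      using a by (simp add: ln_mult_pos)
    have "cmod (b / a) < 1" using 1 a by (simp add: norm_divide)
    from has_integral_diff[OF has_integral_const_real[of "c - ln (cmod a)" 0 1] log_norm_circle_integral_eq_0[OF this]]
    have "((\<lambda>t. c - ln (cmod (a + b * unit_circ t))) has_integral (c - ln (cmod a))) {0..1}"
      by (simp add: eq algebra_simps)
    from nn_integral_Icc_has_integral[OF _ this] upper 1 a b show ?thesis
      by (simp add: max_def)
  next
    case 2
    \<comment> \<open>Conjugating and multiplying by \<open>unit_circ t\<close> preserves the
      modulus and exchanges the roles of \<open>a\<close> and \<open>b\<close>, so that the smaller
      coefficient again stands at the variable.\<close>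
    have "cmod (a + b * unit_circ t) = cmod b * cmod (1 + cnj (a / b) * unit_circ t)" for t
    proof -
      have "cmod (a + b * unit_circ t) = cmod b * cmod (a / b + unit_circ t)"
        using b by (simp flip: norm_mult add: distrib_left)
      also have "cmod (a / b + unit_circ t) = cmod (cnj (a / b + unit_circ t) * unit_circ t)"
        by (simp add: norm_mult del: complex_cnj_add complex_cnj_divide)
      also have "cnj (a / b + unit_circ t) * unit_circ t = 1 + cnj (a / b) * unit_circ t"
        by (simp add: distrib_right unit_circ_cis cis_cnj cis_mult flip: mult.assoc)
      finally show ?thesis .
    qed
    moreover have "1 + cnj (a / b) * unit_circ t \<noteq> 0" for t
    proof
      assume "1 + cnj (a / b) * unit_circ t = 0"
      hence "cmod (cnj (a / b) * unit_circ t) = cmod (- 1)" by (metis add_eq_0_iff)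
      thus False using 2 b by (simp add: norm_mult norm_divide del: complex_cnj_divide)
    qed
    ultimately have eq: "ln (cmod (a + b * unit_circ t)) = ln (cmod b) + ln (cmod (1 + cnj (a / b) * unit_circ t))" for t
      using b by (simp add: ln_mult_pos)
    have "cmod (cnj (a / b)) < 1" using 2 b by (simp add: norm_divide del: complex_cnj_divide)
    from has_integral_diff[OF has_integral_const_real[of "c - ln (cmod b)" 0 1] log_norm_circle_integral_eq_0[OF this]]
    have "((\<lambda>t. c - ln (cmod (a + b * unit_circ t))) has_integral (c - ln (cmod b))) {0..1}"
      by (simp add: eq algebra_simps)
    from nn_integral_Icc_has_integral[OF _ this] upper 2 a b show ?thesis
      by (simp add: max_def)
  next
    case 3
    \<comment> \<open>Now \<open>b / a\<close> lies on the circle, and a rotation of the variable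
      absorbs it.\<close>
    have "cmod (b / a) = 1" using 3 a b by (simp add: norm_divide)
    then obtain \<theta> where \<theta>: "0 \<le> \<theta>" "\<theta> < 2 * pi" "b / a = cis \<theta>"
      using Arg2pi[of "b / a"] by (auto simp: cis_conv_exp is_Arg_def)
    define s where "s = \<theta> / (2 * pi)"
    have s: "0 \<le> s" "s \<le> 1" "b / a = unit_circ s"
      using \<theta> by (auto simp: s_def unit_circ_cis)
    have eq: "cmod (a + b * unit_circ t) = cmod a * cmod (1 + unit_circ (t + s))" for t
      using a by (simp add: unit_circ_add flip: norm_mult s(3)) (simp add: distrib_left mult_ac)
    have "(\<integral>\<^sup>+t\<in>{0..1}. ennreal (c - ln (cmod (a + b * unit_circ t))) \<partial>lborel)
        = (\<integral>\<^sup>+t\<in>{0..1}. ennreal (c - ln (cmod a * cmod (1 + unit_circ t))) \<partial>lborel)"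
      unfolding eq using s
      by (intro nn_integral_periodic_shift) (auto simp: unit_circ_plus_one)
    \<comment> \<open>The rule for the logarithm of a product can fail only at the zero of
      \<open>1 + unit_circ t\<close>, because \<open>ln 0 = 0\<close>.\<close>
    also have "\<dots> = (\<integral>\<^sup>+t\<in>{0..1}. ennreal (c - ln (cmod a) - ln (cmod (1 + unit_circ t))) \<partial>lborel)"
    proof (intro nn_integral_cong_AE AE_I[where N = "{1/2}"] subsetI)
      fix t :: real
      assume t: "t \<in> {t \<in> space lborel. \<not> ennreal (c - ln (cmod a * cmod (1 + unit_circ t))) * indicator {0..1} t =
        ennreal (c - ln (cmod a) - ln (cmod (1 + unit_circ t))) * indicator {0..1} t}"
      have "t \<in> {0..1}"
        by (rule ccontr) (use t in simp)
      moreover have "1 + unit_circ t = 0"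
      proof (rule ccontr)
        assume "1 + unit_circ t \<noteq> 0"
        hence "ln (cmod a * cmod (1 + unit_circ t)) = ln (cmod a) + ln (cmod (1 + unit_circ t))"
          using a by (intro ln_mult_pos) auto
        with t show False by (simp add: diff_diff_eq)
      qed
      ultimately show "t \<in> {1/2}"
        using one_plus_unit_circ_nonzero[of t] by auto
    qed auto
    also have "\<dots> = ennreal (c - ln (cmod a))"
    proof (rule nn_integral_log_norm_one_plus_circle)
      show "ln 2 \<le> c - ln (cmod a)" using c b 3 ln_mult_pos[of 2 "cmod b"] by (simp flip: mult_2)
    qed
    finally show ?thesis using 3 by simp
  qed
qed

subsection \<open>Coefficients as hypergeometric terms\<close>

text \<open>Euler's reflection formula at \<open>1/4\<close>. It trades the \<open>sqrt 2\<close> in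
  the moments for Gamma values, leaving the square of a single one in each prefactor.\<close>

lemma Gamma_quarter_reflection: "Gamma (1/4) * Gamma (3/4 :: real) = pi * sqrt 2"
proof -
  have "Gamma (1/4 :: complex) * Gamma (1 - 1/4) = of_real pi / sin (of_real pi * (1/4))"
    by (rule Gamma_reflection_complex)
  also have "\<dots> = of_real (pi / sin (pi / 4))"
    by (simp flip: sin_of_real)
  also have "Gamma (1/4 :: complex) * Gamma (1 - 1/4) = of_real (Gamma (1/4) * Gamma (3/4))"
    using Gamma_complex_of_real[of "1/4"] Gamma_complex_of_real[of "3/4"] by simp
  finally have "Gamma (1/4) * Gamma (3/4) = pi / sin (pi / 4)"
    by (simp only: of_real_eq_iff)
  also have "\<dots> = pi * sqrt 2" by (simp add: sin_45 field_simps)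
  finally show ?thesis .
qed

text \<open>The factors up to the second line form the coefficient of
  \<open>r powr (n + 1/2)\<close> in \<open>excess r\<close>; the last one is the moment of order
  \<open>n + 1/2\<close> of \<open>cmod (1 + unit_circ t)\<close>.\<close>

definition mahler_term :: "nat \<Rightarrow> real" where
  "mahler_term n = 4 / pi * (arcsin_coeff n / (2 * real n + 1) / 2 ^ (2 * n + 1))
     * (2 powr (real n + 1/2) / pi * Beta ((real n + 3/2) / 2) (1/2))"

lemma Gamma_add_of_nat: "0 < x \<Longrightarrow> Gamma (x + real n) = Gamma x * pochhammer x n" for x :: real
  by (simp add: pochhammer_Gamma Gamma_real_pos field_simps less_imp_neq[OF Gamma_real_pos, symmetric] nonpos_Ints_def)

text \<open>Turns the factors \<open>4 * m + 1\<close> and \<open>4 * m + 3\<close> into quotients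
  of Pochhammer symbols whose parameters differ by one.\<close>

lemma pochhammer_plus_one: "x \<noteq> 0 \<Longrightarrow> pochhammer (x + 1) n = pochhammer x n * (x + real n) / x" for x :: real
  using pochhammer_rec[of x n] by (simp add: pochhammer_Suc field_simps)

lemma powr_nat_plus_half: "0 < x \<Longrightarrow> x powr (real n + 1/2) = x ^ n * sqrt x"
  by (simp add: powr_add powr_half_sqrt powr_realpow)

text \<open>The duplication formula splits \<open>pochhammer (1/2) (2 * m)\<close> and
  \<open>fact (2 * m)\<close>. Of the three factors \<open>4 * m + 1\<close> in the denominator, two
  come from the series coefficient and one from the Beta value; each is a quotient of the symbols
  with parameters \<open>5/4\<close> and \<open>1/4\<close>.\<close>

lemma mahler_term_even:
  "mahler_term (2 * m) = 8 * Gamma (3/4) ^ 2 / pi powr (5/2) *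
    ((pochhammer (1/4) m * pochhammer (1/4) m * pochhammer (1/4) m * pochhammer (3/4) m * pochhammer (3/4) m)
          / (pochhammer (1/2) m * pochhammer (5/4) m * pochhammer (5/4) m * pochhammer (5/4) m)
          * (1/4) ^ m / fact m)"
proof -
  define A B C G H where "A = pochhammer (1/4 :: real) m" and "B = pochhammer (3/4 :: real) m"
    and "C = pochhammer (1/2 :: real) m" and "G = Gamma (1/4 :: real)" and "H = Gamma (3/4 :: real)"
  have pos: "0 < A" "0 < B" "0 < C" "0 < G" "0 < H"
    by (auto simp: A_def B_def C_def G_def H_def intro!: pochhammer_pos Gamma_real_pos)
  define r where "r = 4 * real m + 1"
  have r: "r > 0" by (simp add: r_def)
  have "pochhammer (1/2 :: real) (2 * m) = 4 ^ m * A * B"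
    using pochhammer_double[of "1/4 :: real" m] by (simp add: A_def B_def power_mult)
  moreover have "fact (2 * m) = (4 ^ m * C * fact m :: real)"
    using pochhammer_double[of "1/2 :: real" m] by (simp add: C_def power_mult pochhammer_fact)
  moreover have r': "2 * real (2 * m) + 1 = r" by (simp add: r_def)
  ultimately have coeff: "arcsin_coeff (2 * m) = A * B / (C * fact m) / r"
    unfolding arcsin_coeff_def by (simp only:) (use pos in \<open>simp add: field_simps\<close>)
  have D: "pochhammer (5/4 :: real) m = A * r"
    using pochhammer_plus_one[of "1/4" m] by (simp add: A_def r_def field_simps)
  have "Gamma (5/4 :: real) = G / 4" using Gamma_add_of_nat[of "1/4" 1] by (simp add: G_def)
  hence "Gamma (5/4 + real m) = G / 4 * (A * r)"
    using Gamma_add_of_nat[of "5/4" m] unfolding D by (simp only:)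
  moreover have "Gamma (3/4 + real m) = H * B"
    using Gamma_add_of_nat[of "3/4" m] by (simp add: H_def B_def)
  moreover have "(real (2 * m) + 3 / 2) / 2 = 3/4 + real m" "3/4 + real m + 1/2 = 5/4 + real m"
    by (simp_all add: field_simps)
  ultimately have beta: "Beta ((real (2 * m) + 3 / 2) / 2) (1/2) = H * B * sqrt pi / (G / 4 * (A * r))"
    by (simp only: Beta_def Gamma_one_half_real)
  have sqrt2: "sqrt 2 = 2 * pi / (G * H) "
    using Gamma_quarter_reflection real_sqrt_mult_self[of 2] by (simp add: G_def H_def field_simps)
  have p2: "2 powr (real (2 * m) + 1/2) = 4 ^ m * sqrt 2"
    unfolding powr_nat_plus_half[OF zero_less_numeral] by (simp add: power_mult)
  \<comment> \<open>Squared, the reflection formula exchanges \<open>1 / G\<^sup>2\<close> for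
    \<open>H\<^sup>2\<close>, as the prefactor demands.\<close>
  have "(G * H) * (G * H) = (pi * sqrt 2) * (pi * sqrt 2)"
    using Gamma_quarter_reflection by (simp only: G_def H_def)
  hence GH: "G * (G * (H * H)) = pi * (pi * 2)" by (simp add: mult_ac)
  have ppi: "pi powr (5/2) = pi\<^sup>2 * sqrt pi"
    using powr_add[of pi 2 "1/2"] by (simp add: powr_half_sqrt)
  have p4: "2 ^ (2 * (2 * m) + 1) = (2 * 16 ^ m :: real)" by (simp add: power_mult)
  have p14: "(1/4) ^ m = 4 ^ m / (16 ^ m :: real)" by (simp flip: power_divide)
  show ?thesis
    unfolding mahler_term_def coeff beta p2 ppi D A_def[symmetric] B_def[symmetric] C_def[symmetric] H_def[symmetric]
      r' sqrt2 p4 p14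
    using pos r by (simp add: field_simps power2_eq_square GH)
qed

text \<open>As for even indices, after splitting off the first factor of the symbols of odd length.
  Each of the three factors \<open>4 * m + 3\<close> is \<open>3\<close> times a quotient of symbols
  with parameters \<open>7/4\<close> and \<open>3/4\<close>, whence
  \<open>54 = 2 * 3 ^ 3\<close>.\<close>

lemma mahler_term_odd:
  "mahler_term (2 * m + 1) = Gamma (1/4) ^ 2 / (54 * pi powr (5/2)) *
    ((pochhammer (3/4) m * pochhammer (3/4) m * pochhammer (3/4) m * pochhammer (5/4) m * pochhammer (5/4) m)
          / (pochhammer (3/2) m * pochhammer (7/4) m * pochhammer (7/4) m * pochhammer (7/4) m)
          * (1/4) ^ m / fact m)"
proof -
  define A B C G H where "A = pochhammer (3/4 :: real) m" and "B = pochhammer (5/4 :: real) m"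
    and "C = pochhammer (3/2 :: real) m" and "G = Gamma (1/4 :: real)" and "H = Gamma (3/4 :: real)"
  have pos: "0 < A" "0 < B" "0 < C" "0 < G" "0 < H"
    by (auto simp: A_def B_def C_def G_def H_def intro!: pochhammer_pos Gamma_real_pos)
  define r where "r = 4 * real m + 3"
  have r: "r > 0" by (simp add: r_def)
  have "pochhammer (1/2 :: real) (2 * m + 1) = 4 ^ m * A * B / 2"
    using pochhammer_double[of "3/4 :: real" m] by (simp add: A_def B_def power_mult pochhammer_rec)
  moreover have "fact (2 * m + 1) = (4 ^ m * C * fact m :: real)"
    using pochhammer_double[of "1 :: real" m] pochhammer_rec[of "1 :: real" "2 * m"]
    by (simp add: C_def power_mult pochhammer_fact)
  moreover have r': "2 * real (2 * m + 1) + 1 = r" by (simp add: r_def)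
  ultimately have coeff: "arcsin_coeff (2 * m + 1) = A * B / 2 / (C * fact m) / r"
    unfolding arcsin_coeff_def by (simp only:) (use pos in \<open>simp add: field_simps\<close>)
  have D: "pochhammer (7/4 :: real) m = A * r / 3"
    using pochhammer_plus_one[of "3/4" m] by (simp add: A_def r_def field_simps)
  have G5: "Gamma (5/4 :: real) = G / 4" using Gamma_add_of_nat[of "1/4" 1] by (simp add: G_def)
  have "Gamma (7/4 :: real) = 3 * H / 4" using Gamma_add_of_nat[of "3/4" 1] by (simp add: H_def)
  hence "Gamma (7/4 + real m) = 3 * H / 4 * (A * r / 3)"
    using Gamma_add_of_nat[of "7/4" m] unfolding D by (simp only:)
  moreover have "Gamma (5/4 + real m) = G / 4 * B"
    using Gamma_add_of_nat[of "5/4" m] unfolding G5 B_def by (simp only:)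
  moreover have "(real (2 * m + 1) + 3 / 2) / 2 = 5/4 + real m" "5/4 + real m + 1/2 = 7/4 + real m"
    by (simp_all add: field_simps)
  ultimately have beta: "Beta ((real (2 * m + 1) + 3 / 2) / 2) (1/2) = G / 4 * B * sqrt pi / (3 * H / 4 * (A * r / 3))"
    by (simp only: Beta_def Gamma_one_half_real)
  have p2: "2 powr (real (2 * m + 1) + 1/2) = 2 * 4 ^ m * sqrt 2"
    unfolding powr_nat_plus_half[OF zero_less_numeral] by (simp add: power_mult)
  have ppi: "pi powr (5/2) = pi\<^sup>2 * sqrt pi"
    using powr_add[of pi 2 "1/2"] by (simp add: powr_half_sqrt)
  have sqrt2: "sqrt 2 = G * H / pi"
    using Gamma_quarter_reflection by (simp add: G_def H_def field_simps)
  have p4: "2 ^ (2 * (2 * m + 1) + 1) = (8 * 16 ^ m :: real)" by (simp add: power_mult power_add)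
  have p14: "(1/4) ^ m = 4 ^ m / (16 ^ m :: real)" by (simp flip: power_divide)
  show ?thesis
    unfolding mahler_term_def coeff beta p2 ppi D A_def[symmetric] B_def[symmetric] C_def[symmetric] G_def[symmetric]
      r' sqrt2 p4 p14
    using pos r by (simp add: field_simps power2_eq_square)
qed

subsection \<open>The mean of the positive part\<close>

lemma norm_one_plus_unit_circ_le: "cmod (1 + unit_circ t) \<le> 2"
  using norm_triangle_ineq[of 1 "unit_circ t"] by simp

text \<open>For \<open>0 < r \<le> 2\<close> this is the mean of
  \<open>max (2 * ln (cmod (1 + x))) (ln r)\<close> over the circle. The constant doubles that of
  \<open>max_log_sine_integral\<close>, the circle being two copies of
  \<open>{0..1/2}\<close>.\<close>

definition excess :: "real \<Rightarrow> real" where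
  "excess r = 4 / pi * arcsin_integral (sqrt r / 2)"

text \<open>As \<open>2 * ln (cmod (1 + x))\<close> is at most \<open>ln 4\<close>, the integrand is
  nonnegative. So is its integral, and the resulting bound on \<open>excess r\<close> later lets
  \<open>c - excess r\<close> and \<open>excess r\<close> be added without truncation.\<close>

lemma nn_integral_max_log_circle:
  assumes r: "0 < r" "r \<le> 2" and c: "ln 4 \<le> c"
  shows "(\<integral>\<^sup>+t\<in>{0..1}. ennreal (c - max (2 * ln (cmod (1 + unit_circ t))) (ln r)) \<partial>lborel)
       = ennreal (c - excess r)" and "excess r \<le> c"
proof -
  have nonneg: "0 \<le> c - max (2 * ln (2 * sin (pi * t))) (ln r)" if "t \<in> {0..1/2}" for t
  proof -
    have "ln (4 :: real) = 2 * ln 2" using ln_realpow[of 2 2] by simp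
    moreover have "ln r \<le> ln 2" using r by simp
    ultimately show ?thesis using c ln_two_sine_le[of t] that ln_gt_zero[of "2 :: real"] by (simp; linarith)
  qed
  have int: "((\<lambda>t. c - max (2 * ln (2 * sin (pi * t))) (ln r)) has_integral (c - excess r) / 2) {0..1/2}"
    using has_integral_diff[OF has_integral_const_real[of c 0 "1/2"] max_log_sine_integral[OF r]]
    by (simp add: excess_def diff_divide_distrib)
  from has_integral_nonneg[OF this nonneg] show "excess r \<le> c" by simp
  have "(\<integral>\<^sup>+t\<in>{0..1}. ennreal (c - max (2 * ln (cmod (1 + unit_circ t))) (ln r)) \<partial>lborel)
     = 2 * (\<integral>\<^sup>+t\<in>{0..1/2}. ennreal (c - max (2 * ln (2 * sin (pi * t))) (ln r)) \<partial>lborel)"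
    by (subst nn_integral_circle_eq_sine[where h = "\<lambda>x. ennreal (c - max (2 * ln x) (ln r))"]) auto
  also have "(\<integral>\<^sup>+t\<in>{0..1/2}. ennreal (c - max (2 * ln (2 * sin (pi * t))) (ln r)) \<partial>lborel) = ennreal ((c - excess r) / 2)"
    using nonneg int by (rule nn_integral_Icc_has_integral)
  also have "2 * ennreal ((c - excess r) / 2) = ennreal (c - excess r)"
    by (rule ennreal_double_half)
  finally show "(\<integral>\<^sup>+t\<in>{0..1}. ennreal (c - max (2 * ln (cmod (1 + unit_circ t))) (ln r)) \<partial>lborel)
       = ennreal (c - excess r)" .
qed

definition excess_coeff :: "nat \<Rightarrow> real" where
  "excess_coeff n = 4 / pi * (arcsin_coeff n / (2 * real n + 1) / 2 ^ (2 * n + 1))"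

lemma excess_coeff_nonneg: "0 \<le> excess_coeff n"
  by (simp add: excess_coeff_def arcsin_coeff_nonneg)

lemma excess_sums:
  assumes r: "0 < r" "r \<le> 2"
  shows "(\<lambda>n. excess_coeff n * r powr (real n + 1/2)) sums excess r"
proof -
  have "(\<lambda>n. arcsin_coeff n / (2 * real n + 1) * ((sqrt r / 2)\<^sup>2) ^ n) sums
      (\<Sum>n. arcsin_coeff n / (2 * real n + 1) * ((sqrt r / 2)\<^sup>2) ^ n)"
    by (intro summable_sums summable_arcsin_integral_coeff) (use r in \<open>simp add: power_divide\<close>)
  from sums_mult[OF this, of "4 / pi * (sqrt r / 2)"] have "(\<lambda>n. 4 / pi * (sqrt r / 2) * (arcsin_coeff n / (2 * real n + 1) * ((sqrt r / 2)\<^sup>2) ^ n)) sums excess r"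
    by (simp add: excess_def arcsin_integral_def mult.assoc)
  also have "(\<lambda>n. 4 / pi * (sqrt r / 2) * (arcsin_coeff n / (2 * real n + 1) * ((sqrt r / 2)\<^sup>2) ^ n))
      = (\<lambda>n. excess_coeff n * r powr (real n + 1/2))"
    using r by (intro ext, simp add: excess_coeff_def powr_nat_plus_half power_divide power_mult, simp add: mult_ac)
  finally show ?thesis .
qed

lemma nn_integral_norm_powr:
  assumes s: "0 \<le> s"
  shows "(\<integral>\<^sup>+t\<in>{0..1}. ennreal (cmod (1 + unit_circ t) powr s) \<partial>lborel)
       = ennreal (2 powr s / pi * Beta ((s + 1) / 2) (1/2))"
proof -
  have nonneg: "0 \<le> sin (pi * t)" if "t \<in> {0..1/2}" for t
    using that sin_pi_pos[of t] by (cases "t = 0") auto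
  have "((\<lambda>t. 2 powr s * sin (pi * t) powr s) has_integral (2 powr s * (Beta ((s + 1) / 2) (1 / 2) / (2 * pi)))) {0..1/2}"
    using s by (intro has_integral_mult_right sine_powr_integral) simp
  hence int: "((\<lambda>t. (2 * sin (pi * t)) powr s) has_integral (2 powr s * (Beta ((s + 1) / 2) (1 / 2) / (2 * pi)))) {0..1/2}"
    by (subst has_integral_cong[where g = "\<lambda>t. 2 powr s * sin (pi * t) powr s"]) (auto simp: powr_mult nonneg)
  have "(\<integral>\<^sup>+t\<in>{0..1}. ennreal (cmod (1 + unit_circ t) powr s) \<partial>lborel)
     = 2 * (\<integral>\<^sup>+t\<in>{0..1/2}. ennreal ((2 * sin (pi * t)) powr s) \<partial>lborel)"
    by (subst nn_integral_circle_eq_sine[where h = "\<lambda>x. ennreal (x powr s)"]) auto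
  also have "(\<integral>\<^sup>+t\<in>{0..1/2}. ennreal ((2 * sin (pi * t)) powr s) \<partial>lborel)
      = ennreal (2 powr s * (Beta ((s + 1) / 2) (1 / 2) / (2 * pi)))"
    by (rule nn_integral_Icc_has_integral[OF _ int]) simp
  also have "2 * ennreal (2 powr s * (Beta ((s + 1) / 2) (1 / 2) / (2 * pi)))
      = ennreal (2 powr s / pi * Beta ((s + 1) / 2) (1/2))"
    using ennreal_double_half[of "2 powr s / pi * Beta ((s + 1) / 2) (1/2)"] by (simp add: mult_ac)
  finally show ?thesis .
qed

lemma mahler_term_nonneg: "0 \<le> mahler_term n"
proof -
  have "0 < Beta ((real n + 3/2) / 2) (1/2 :: real)"
    by (auto simp: Beta_def intro!: mult_pos_pos divide_pos_pos Gamma_real_pos add_nonneg_pos)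
  thus ?thesis by (auto simp: mahler_term_def arcsin_coeff_nonneg)
qed

text \<open>All terms are nonnegative, so sum and integral commute before convergence is known; the
  common value \<open>top\<close> is not yet excluded.\<close>

lemma nn_integral_excess:
  "(\<integral>\<^sup>+t\<in>{0..1}. ennreal (excess (cmod (1 + unit_circ t))) \<partial>lborel) = (\<Sum>n. ennreal (mahler_term n))"
proof -
  have summand: "ennreal (mahler_term n) = (\<integral>\<^sup>+t. ennreal (excess_coeff n * cmod (1 + unit_circ t) powr (real n + 1/2)) * indicator {0..1} t \<partial>lborel)" for n
  proof -
    have "ennreal (mahler_term n) = ennreal (excess_coeff n) * ennreal (2 powr (real n + 1/2) / pi * Beta ((real n + 1/2 + 1) / 2) (1/2))"
      by (simp add: mahler_term_def excess_coeff_def arcsin_coeff_nonneg add.commute flip: ennreal_mult')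
    also have "\<dots> = ennreal (excess_coeff n) * (\<integral>\<^sup>+t\<in>{0..1}. ennreal (cmod (1 + unit_circ t) powr (real n + 1/2)) \<partial>lborel)"
      by (subst nn_integral_norm_powr) auto
    also have "\<dots> = (\<integral>\<^sup>+t. ennreal (excess_coeff n) * (ennreal (cmod (1 + unit_circ t) powr (real n + 1/2)) * indicator {0..1} t) \<partial>lborel)"
      by (subst nn_integral_cmult) auto
    finally show ?thesis by (simp add: ennreal_mult' excess_coeff_nonneg mult.assoc)
  qed
  have "(\<Sum>n. ennreal (mahler_term n))
      = (\<integral>\<^sup>+t. (\<Sum>n. ennreal (excess_coeff n * cmod (1 + unit_circ t) powr (real n + 1/2)) * indicator {0..1} t) \<partial>lborel)"
    unfolding summand by (subst nn_integral_suminf) auto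
  also have "\<dots> = (\<integral>\<^sup>+t\<in>{0..1}. ennreal (excess (cmod (1 + unit_circ t))) \<partial>lborel)"
  proof (intro nn_integral_cong_AE AE_I[where N = "{1/2}"] subsetI, goal_cases)
    case (1 t)
    have "t = 1/2"
    proof (rule ccontr)
      assume "t \<noteq> 1/2"
      moreover have "t \<in> {0..1}" by (rule ccontr) (use 1 in simp)
      ultimately have "(\<lambda>n. excess_coeff n * cmod (1 + unit_circ t) powr (real n + 1/2)) sums excess (cmod (1 + unit_circ t))"
        using one_plus_unit_circ_nonzero[of t] norm_one_plus_unit_circ_le[of t] by (intro excess_sums) auto
      hence "(\<Sum>n. ennreal (excess_coeff n * cmod (1 + unit_circ t) powr (real n + 1/2))) = ennreal (excess (cmod (1 + unit_circ t)))"
        by (simp add: suminf_ennreal2 excess_coeff_nonneg sums_iff)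
      with 1 show False by simp
    qed
    thus ?case by simp
  qed auto
  finally show ?thesis by simp
qed

subsection \<open>The Mahler measure\<close>

lemma nn_integral_unit_square_swap:
  fixes k :: "real \<Rightarrow> real \<Rightarrow> ennreal"
  assumes [measurable]: "(\<lambda>(x, y). k x y) \<in> borel_measurable (lborel \<Otimes>\<^sub>M lborel)"
  shows "(\<integral>\<^sup>+x\<in>{0..1}. (\<integral>\<^sup>+y\<in>{0..1}. k x y \<partial>lborel) \<partial>lborel) = (\<integral>\<^sup>+y\<in>{0..1}. (\<integral>\<^sup>+x\<in>{0..1}. k x y \<partial>lborel) \<partial>lborel)"
proof -
  have "(\<integral>\<^sup>+x\<in>{0..1}. (\<integral>\<^sup>+y\<in>{0..1}. k x y \<partial>lborel) \<partial>lborel)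
      = (\<integral>\<^sup>+x. (\<integral>\<^sup>+y. k x y * indicator {0..1} x * indicator {0..1} y \<partial>lborel) \<partial>lborel)"
    by (subst nn_integral_multc[symmetric]) (auto simp: mult_ac)
  also have "\<dots> = (\<integral>\<^sup>+y. (\<integral>\<^sup>+x. k x y * indicator {0..1} x * indicator {0..1} y \<partial>lborel) \<partial>lborel)"
    by (rule lborel_pair.Fubini'[symmetric]) measurable
  also have "\<dots> = (\<integral>\<^sup>+y\<in>{0..1}. (\<integral>\<^sup>+x\<in>{0..1}. k x y \<partial>lborel) \<partial>lborel)"
    by (subst nn_integral_multc) auto
  finally show ?thesis .
qed

text \<open>With \<open>v = s + u\<close> the polynomial becomes
  \<open>a + (1 + unit_circ s) * unit_circ u\<close>, linear in the second variable, and Jensen's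
  formula evaluates the integral over \<open>u\<close>. The hypothesis on \<open>t\<close> makes
  \<open>a\<close> nonzero.\<close>

lemma nn_integral_mahler_fiber:
  assumes t: "t \<in> {0..1}" "t \<noteq> 1/2"
  shows "(\<integral>\<^sup>+u\<in>{0..1}. (\<integral>\<^sup>+v\<in>{0..1}. ennreal (ln 6 - ln (cmod ((1 + unit_circ t)\<^sup>2 + unit_circ u + unit_circ v))) \<partial>lborel) \<partial>lborel)
    = (\<integral>\<^sup>+s\<in>{0..1}. ennreal (ln 6 - max (2 * ln (cmod (1 + unit_circ t))) (ln (cmod (1 + unit_circ s)))) \<partial>lborel)"
proof -
  define a where "a = (1 + unit_circ t)\<^sup>2"
  have a: "a \<noteq> 0" using one_plus_unit_circ_nonzero[OF t] by (simp add: a_def)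
  have a4: "cmod a \<le> 4"
    using power_mono[OF norm_one_plus_unit_circ_le[of t], of 2] by (simp add: a_def norm_power)
  define k where "k = (\<lambda>u v. ennreal (ln 6 - ln (cmod (a + unit_circ u + unit_circ v))))"
  have "(\<integral>\<^sup>+u\<in>{0..1}. (\<integral>\<^sup>+v\<in>{0..1}. k u v \<partial>lborel) \<partial>lborel)
      = (\<integral>\<^sup>+u\<in>{0..1}. (\<integral>\<^sup>+s\<in>{0..1}. k u (s + u) \<partial>lborel) \<partial>lborel)"
  proof (rule nn_integral_cong)
    fix u :: real
    have "(\<integral>\<^sup>+s\<in>{0..1}. k u (s + u) \<partial>lborel) = (\<integral>\<^sup>+v\<in>{0..1}. k u v \<partial>lborel)" if "0 \<le> u" "u \<le> 1"
      by (rule nn_integral_periodic_shift) (use that in \<open>simp_all add: k_def unit_circ_plus_one\<close>)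
    thus "(\<integral>\<^sup>+v\<in>{0..1}. k u v \<partial>lborel) * indicator {0..1} u = (\<integral>\<^sup>+s\<in>{0..1}. k u (s + u) \<partial>lborel) * indicator {0..1} u"
      by (cases "u \<in> {0..1}") simp_all
  qed
  also have "\<dots> = (\<integral>\<^sup>+s\<in>{0..1}. (\<integral>\<^sup>+u\<in>{0..1}. k u (s + u) \<partial>lborel) \<partial>lborel)"
    unfolding k_def by (intro nn_integral_unit_square_swap) measurable
  also have "\<dots> = (\<integral>\<^sup>+s\<in>{0..1}. ennreal (ln 6 - max (ln (cmod a)) (ln (cmod (1 + unit_circ s)))) \<partial>lborel)"
  proof (intro nn_integral_cong_AE AE_I[where N = "{1/2}"] subsetI, goal_cases)
    case (1 s)
    have "s = 1/2"
    proof (rule ccontr)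
      assume "s \<noteq> 1/2"
      moreover have "s \<in> {0..1}" by (rule ccontr) (use 1 in simp)
      ultimately have b: "1 + unit_circ s \<noteq> 0" by (rule one_plus_unit_circ_nonzero[rotated])
      \<comment> \<open>The constant \<open>6\<close> arises here as \<open>4 + 2\<close>.\<close>
      have "cmod a + cmod (1 + unit_circ s) \<le> 6" "0 < cmod a + cmod (1 + unit_circ s)"
        using a4 norm_one_plus_unit_circ_le[of s] a by (auto intro: add_pos_nonneg)
      hence "ln (cmod a + cmod (1 + unit_circ s)) \<le> ln 6" by simp
      from nn_integral_jensen_linear[OF a b _ this]
      have "(\<integral>\<^sup>+u\<in>{0..1}. k u (s + u) \<partial>lborel) = ennreal (ln 6 - max (ln (cmod a)) (ln (cmod (1 + unit_circ s))))"
        by (simp add: k_def unit_circ_add algebra_simps)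
      with 1 show False by simp
    qed
    thus ?case by simp
  qed auto
  also have "ln (cmod a) = 2 * ln (cmod (1 + unit_circ t))"
    using one_plus_unit_circ_nonzero[OF t] by (simp add: a_def norm_power ln_realpow)
  finally show ?thesis by (simp add: k_def a_def)
qed

text \<open>Tonelli's theorem moves the average over \<open>t\<close> inside, where
  \<open>r = cmod (1 + unit_circ s)\<close> is fixed and the result is
  \<open>excess r\<close>.\<close>

lemma nn_integral_mahler:
  "(\<integral>\<^sup>+t\<in>{0..1}. (\<integral>\<^sup>+u\<in>{0..1}. (\<integral>\<^sup>+v\<in>{0..1}.
      ennreal (ln 6 - ln (cmod ((1 + unit_circ t)\<^sup>2 + unit_circ u + unit_circ v))) \<partial>lborel) \<partial>lborel) \<partial>lborel)
    = (\<integral>\<^sup>+s\<in>{0..1}. ennreal (ln 6 - excess (cmod (1 + unit_circ s))) \<partial>lborel)" (is "?L = _")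
proof -
  have "?L = (\<integral>\<^sup>+t\<in>{0..1}. (\<integral>\<^sup>+s\<in>{0..1}. ennreal (ln 6 - max (2 * ln (cmod (1 + unit_circ t))) (ln (cmod (1 + unit_circ s)))) \<partial>lborel) \<partial>lborel)"
  proof (intro nn_integral_cong_AE AE_I[where N = "{1/2}"] subsetI, goal_cases)
    case (1 t)
    show ?case
    proof (rule ccontr)
      assume "t \<notin> {1/2}"
      moreover have "t \<in> {0..1}" by (rule ccontr) (use 1 in simp)
      ultimately show False using 1 nn_integral_mahler_fiber[of t] by simp
    qed
  qed auto
  also have "\<dots> = (\<integral>\<^sup>+s\<in>{0..1}. (\<integral>\<^sup>+t\<in>{0..1}. ennreal (ln 6 - max (2 * ln (cmod (1 + unit_circ t))) (ln (cmod (1 + unit_circ s)))) \<partial>lborel) \<partial>lborel)"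
    by (intro nn_integral_unit_square_swap) measurable
  also have "\<dots> = (\<integral>\<^sup>+s\<in>{0..1}. ennreal (ln 6 - excess (cmod (1 + unit_circ s))) \<partial>lborel)"
  proof (intro nn_integral_cong_AE AE_I[where N = "{1/2}"] subsetI, goal_cases)
    case (1 s)
    show ?case
    proof (rule ccontr)
      assume "s \<notin> {1/2}"
      moreover have "s \<in> {0..1}" by (rule ccontr) (use 1 in simp)
      ultimately show False
        using 1 nn_integral_max_log_circle(1)[of "cmod (1 + unit_circ s)" "ln 6"]
          one_plus_unit_circ_nonzero[of s] norm_one_plus_unit_circ_le[of s] by simp
    qed
  qed auto
  finally show ?thesis .
qed

lemma excess_nonneg: "0 < r \<Longrightarrow> r \<le> 2 \<Longrightarrow> 0 \<le> excess r"
  using sums_le[OF _ sums_zero excess_sums[of r]] by (simp add: excess_coeff_nonneg)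

lemma excess_measurable [measurable]: "excess \<in> borel_measurable borel"
  unfolding excess_def[abs_def] arcsin_integral_def by measurable

lemma mahler_eq_suminf:
  "summable mahler_term"
  "mahler_measure3 (\<lambda>x1 x2 x3. (1 + x1)\<^sup>2 + x2 + x3) = (\<Sum>n. mahler_term n)"
proof -
  define X where "X = (\<integral>\<^sup>+s\<in>{0..1}. ennreal (ln 6 - excess (cmod (1 + unit_circ s))) \<partial>lborel)"
  define S where "S = (\<Sum>n. mahler_term n)"
  \<comment> \<open>The two nonnegative integrands add up to \<open>ln 6\<close> almost everywhere,
    which expresses \<open>X\<close> through the series.\<close>
  have "X + (\<integral>\<^sup>+s\<in>{0..1}. ennreal (excess (cmod (1 + unit_circ s))) \<partial>lborel)
      = (\<integral>\<^sup>+s. ennreal (ln 6 - excess (cmod (1 + unit_circ s))) * indicator {0..1} s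
            + ennreal (excess (cmod (1 + unit_circ s))) * indicator {0..1} s \<partial>lborel)"
    unfolding X_def by (subst nn_integral_add) auto
  also have "\<dots> = (\<integral>\<^sup>+s. ennreal (ln 6) * indicator {0..1} (s :: real) \<partial>lborel)"
  proof (intro nn_integral_cong_AE AE_I[where N = "{1/2}"] subsetI, goal_cases)
    case (1 s)
    show ?case
    proof (rule ccontr)
      assume "s \<notin> {1/2}"
      moreover have s: "s \<in> {0..1}" by (rule ccontr) (use 1 in simp)
      ultimately have r: "0 < cmod (1 + unit_circ s)" "cmod (1 + unit_circ s) \<le> 2"
        using one_plus_unit_circ_nonzero[of s] norm_one_plus_unit_circ_le[of s] by auto
      have "ennreal (ln 6 - excess (cmod (1 + unit_circ s))) + ennreal (excess (cmod (1 + unit_circ s))) = ennreal (ln 6)"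
        using excess_nonneg[OF r] nn_integral_max_log_circle(2)[OF r, of "ln 6"] by (simp flip: ennreal_plus)
      with 1 s show False by simp
    qed
  qed auto
  also have "\<dots> = ennreal (ln 6)"
    by (subst nn_integral_cmult_indicator) auto
  finally have sum: "X + (\<Sum>n. ennreal (mahler_term n)) = ennreal (ln 6)"
    by (simp add: nn_integral_excess)
  \<comment> \<open>Convergence of the series comes from here: its sum cannot exceed
    \<open>ln 6\<close>.\<close>
  hence finite: "(\<Sum>n. ennreal (mahler_term n)) \<noteq> top"
    by (metis ennreal_add_eq_top ennreal_neq_top)
  show summable: "summable mahler_term"
    using finite mahler_term_nonneg by (intro summable_suminf_not_top) auto
  have S: "0 \<le> S" "(\<Sum>n. ennreal (mahler_term n)) = ennreal S"
    using summable mahler_term_nonneg by (auto simp: S_def suminf_ennreal2 intro: suminf_nonneg)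
  from sum have "X = ennreal (ln 6 - S)" "S \<le> ln 6"
  proof -
    have "ennreal S \<le> ennreal (ln 6)" unfolding sum[symmetric] S by (rule add_increasing) simp_all
    thus "S \<le> ln 6" by (simp add: ennreal_le_iff)
    have "X = ennreal (ln 6) - ennreal S" unfolding sum[symmetric] S by (rule ennreal_add_diff_cancel_right[symmetric]) simp
    thus "X = ennreal (ln 6 - S)" using S(1) by (simp add: ennreal_minus)
  qed
  note X = this

  let ?Q = "{0..1::real} \<times> {0..1::real} \<times> {0..1::real}"
  define f where "f = (\<lambda>p :: real \<times> real \<times> real.
    ln (cmod ((1 + unit_circ (fst p))\<^sup>2 + unit_circ (fst (snd p)) + unit_circ (snd (snd p)))))"
  have f_meas [measurable]: "f \<in> borel_measurable (lborel \<Otimes>\<^sub>M lborel \<Otimes>\<^sub>M lborel)"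
    unfolding f_def by measurable
  have f_le: "f p \<le> ln 6" for p
  proof (cases "(1 + unit_circ (fst p))\<^sup>2 + unit_circ (fst (snd p)) + unit_circ (snd (snd p)) = 0")
    case False
    have "cmod ((1 + unit_circ (fst p))\<^sup>2) \<le> 2\<^sup>2"
      unfolding norm_power by (intro power_mono norm_one_plus_unit_circ_le) simp
    hence "cmod ((1 + unit_circ (fst p))\<^sup>2 + unit_circ (fst (snd p)) + unit_circ (snd (snd p))) \<le> 2\<^sup>2 + 1 + 1"
      by (intro norm_triangle_mono) simp_all
    thus ?thesis using False by (simp add: f_def)
  qed (simp add: f_def)
  have sigma_finite: "sigma_finite_measure (lborel \<Otimes>\<^sub>M lborel :: (real \<times> real) measure)"
    unfolding lborel_prod by (rule sigma_finite_lborel)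
  have "(\<integral>\<^sup>+p. ennreal (indicator ?Q p *\<^sub>R (ln 6 - f p)) \<partial>lborel)
      = (\<integral>\<^sup>+p. ennreal (ln 6 - f p) * indicator ?Q p \<partial>(lborel \<Otimes>\<^sub>M lborel \<Otimes>\<^sub>M lborel))"
    unfolding lborel_prod by (intro nn_integral_cong) (auto simp: indicator_def)
  also have "\<dots> = (\<integral>\<^sup>+t. \<integral>\<^sup>+q. ennreal (ln 6 - f (t, q)) * indicator ?Q (t, q) \<partial>(lborel \<Otimes>\<^sub>M lborel) \<partial>lborel)"
    by (rule sigma_finite_measure.nn_integral_fst[OF sigma_finite, symmetric]) measurable
  also have "\<dots> = (\<integral>\<^sup>+t. \<integral>\<^sup>+u. \<integral>\<^sup>+v. ennreal (ln 6 - f (t, u, v)) * indicator ?Q (t, u, v) \<partial>lborel \<partial>lborel \<partial>lborel)"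
    by (intro nn_integral_cong lborel.nn_integral_fst[symmetric]) measurable
  also have "\<dots> = (\<integral>\<^sup>+t\<in>{0..1}. (\<integral>\<^sup>+u\<in>{0..1}. (\<integral>\<^sup>+v\<in>{0..1}. ennreal (ln 6 - f (t, u, v)) \<partial>lborel) \<partial>lborel) \<partial>lborel)"
  proof (rule nn_integral_cong)
    fix t :: real
    show "(\<integral>\<^sup>+u. \<integral>\<^sup>+v. ennreal (ln 6 - f (t, u, v)) * indicator ?Q (t, u, v) \<partial>lborel \<partial>lborel)
        = (\<integral>\<^sup>+u\<in>{0..1}. (\<integral>\<^sup>+v\<in>{0..1}. ennreal (ln 6 - f (t, u, v)) \<partial>lborel) \<partial>lborel) * indicator {0..1} t"
    proof -
      have "(\<integral>\<^sup>+v. ennreal (ln 6 - f (t, u, v)) * indicator ?Q (t, u, v) \<partial>lborel)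
          = (\<integral>\<^sup>+v\<in>{0..1}. ennreal (ln 6 - f (t, u, v)) \<partial>lborel) * indicator {0..1} u * indicator {0..1} t" for u
        by (cases "u \<in> {0..1}"; cases "t \<in> {0..1}") (simp_all add: indicator_times)
      thus ?thesis
        by (cases "t \<in> {0..1}") simp_all
    qed
  qed
  also have "\<dots> = X"
    unfolding X_def nn_integral_mahler[symmetric] f_def by simp
  finally have nn: "(\<integral>\<^sup>+p. ennreal (indicator ?Q p *\<^sub>R (ln 6 - f p)) \<partial>lborel) = ennreal (ln 6 - S)"
    by (simp add: X)
  have "emeasure (lborel \<Otimes>\<^sub>M lborel \<Otimes>\<^sub>M lborel) ?Q = 1"
    by (simp add: sigma_finite_measure.emeasure_pair_measure_Times[OF sigma_finite] lborel.emeasure_pair_measure_Times)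
  hence Q: "?Q \<in> sets lborel" "emeasure lborel ?Q = 1"
    by (auto simp: lborel_prod intro!: borel_closed closed_Times)
  note [measurable] = f_meas[unfolded lborel_prod] Q(1)
  \<comment> \<open>A nonnegative function with finite integral is Bochner integrable; integrability
    of \<open>f\<close> then follows by subtraction from \<open>ln 6\<close> on a cube of volume
    one.\<close>
  have 1: "has_bochner_integral lborel (\<lambda>p. indicator ?Q p *\<^sub>R (ln 6 - f p)) (ln 6 - S)"
  proof (rule has_bochner_integral_nn_integral[OF _ _ _ nn])
    show "(\<lambda>p. indicator ?Q p *\<^sub>R (ln 6 - f p)) \<in> borel_measurable lborel"
      by measurable
  qed (use X(2) f_le in auto)
  have "has_bochner_integral lborel (\<lambda>p. indicator ?Q p *\<^sub>R ln 6) (measure lborel ?Q *\<^sub>R ln 6)"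
    using Q by (intro has_bochner_integral_scaleR_left has_bochner_integral_real_indicator) auto
  hence 2: "has_bochner_integral lborel (\<lambda>p. indicator ?Q p *\<^sub>R ln 6) (ln 6)"
    using Q by (simp add: measure_def)
  have "has_bochner_integral lborel (\<lambda>p. indicator ?Q p *\<^sub>R f p) S"
    using has_bochner_integral_diff[OF 2 1] by (simp add: algebra_simps)
  thus "mahler_measure3 (\<lambda>x1 x2 x3. (1 + x1)\<^sup>2 + x2 + x3) = (\<Sum>n. mahler_term n)"
    unfolding mahler_measure3_def set_lebesgue_integral_def S_def[symmetric]
    by (simp add: f_def has_bochner_integral_integral_eq)
qed

theorem theorem3:
  shows "mahler_measure3 (\<lambda>x1 x2 x3. (1 + x1)\<^sup>2 + x2 + x3) =
    8 * Gamma (3/4) ^ 2 / pi powr (5/2) *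
      hyp5F4 (1/4) (1/4) (1/4) (3/4) (3/4) (1/2) (5/4) (5/4) (5/4) (1/4)
    + Gamma (1/4) ^ 2 / (54 * pi powr (5/2)) *
      hyp5F4 (3/4) (3/4) (3/4) (5/4) (5/4) (3/2) (7/4) (7/4) (7/4) (1/4)"
proof -
  have even: "summable (\<lambda>m. mahler_term (2 * m))" and odd: "summable (\<lambda>m. mahler_term (2 * m + 1))"
    using summable_reindex[OF mahler_eq_suminf(1), of "\<lambda>m. 2 * m"] summable_reindex[OF mahler_eq_suminf(1), of "\<lambda>m. 2 * m + 1"]
    by (auto simp: o_def inj_on_def mahler_term_nonneg)
  have "(\<lambda>n. if even n then mahler_term (2 * (n div 2)) else mahler_term (2 * ((n - 1) div 2) + 1)) sums
      ((\<Sum>m. mahler_term (2 * m)) + (\<Sum>m. mahler_term (2 * m + 1)))"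
    using sums_if[OF summable_sums[OF odd] summable_sums[OF even]] by (simp add: add.commute)
  also have "(\<lambda>n. if even n then mahler_term (2 * (n div 2)) else mahler_term (2 * ((n - 1) div 2) + 1)) = mahler_term"
    by (intro ext) (auto elim: oddE)
  finally have "(\<Sum>n. mahler_term n) = (\<Sum>m. mahler_term (2 * m)) + (\<Sum>m. mahler_term (2 * m + 1))"
    by (simp add: sums_iff)
  \<comment> \<open>Nonzero prefactors are what lets summability pass from the terms
    \<open>mahler_term\<close> to the hypergeometric terms, after which the constants can be pulled
    out of the sums.\<close>
  moreover have "Gamma (3/4 :: real) \<noteq> 0" "Gamma (1/4 :: real) \<noteq> 0"
    using less_imp_neq[OF Gamma_real_pos, of "3/4"] less_imp_neq[OF Gamma_real_pos, of "1/4"] by simp_all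
  hence "8 * Gamma (3/4 :: real) ^ 2 / pi powr (5/2) \<noteq> 0" "Gamma (1/4 :: real) ^ 2 / (54 * pi powr (5/2)) \<noteq> 0"
    by auto
  ultimately show ?thesis
    using even odd unfolding mahler_eq_suminf(2) hyp5F4_def mahler_term_even mahler_term_odd
    by (simp only: summable_cmult_iff simp_thms suminf_mult)
qed

end
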